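(* Let $d\ge2$ and let $E\subset[1,2]$ be a nonempty Assouad regular set with $\dim_M(E)=\beta$ and $\dim_A(E)=\gamma>0$. Let $1\le p,q\le\infty$ and $r>0$. If $\mathcal{A}_E:L^p\times L^q\to L^r$ is bounded, then $$\frac1r\le\frac1p+\frac1q\le1+m_{linear}(d,r,\beta,\gamma),$$ where $$m_{linear}(d,r,\beta,\gamma):=\min\left\{\frac{d-1}{d}+\frac{1-\beta}{dr},\ \frac{\beta(d-1)}{\beta(d-1)+2\gamma}+\frac{(d-\beta)2\gamma-(d-1)\beta}{\beta(d-1)+2\gamma}\,\frac1r,\ \frac dr\right\}.$$
   Context: $\sigma_{2d-1}$ is the normalized spherical measure on the unit sphere $S^{2d-1}\subset\mathbb{R}^{2d}$, and $$\mathcal{A}_E(f,g)(x)=\sup_{t\in E}\left|\int_{S^{2d-1}}f(x-ty)g(x-tz)\,d\sigma_{2d-1}(y,z)\right|,\quad x\in\mathbb{R}^d.$$ Boundedness means $\|\mathcal{A}_E(f,g)\|_{L^r}\le C\|f\|_{L^p}\|g\|_{L^q}$ with $C$ independent of $f,g$. $N(F,\delta)$ is the minimal number of closed intervals of length $\delta$ needed to cover $F$. The upper Minkowski dimension is $\dim_M(E)=\limsup_{\delta\to0}\frac{\log N(E,\delta)}{\log(1/\delta)}$. The upper Assouad dimension $\dim_A(E)$ is the smallest nonnegative number $\gamma$ such that there exist $\delta_0>0$ and, for every $\varepsilon>0$, a constant $C_\varepsilon>0$ such that for any $\delta<\delta_0$ and any interval $I\subset[1,2]$ with $\delta<|I|<\delta_0$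 one has $N(E\cap I,\delta)\le C_\varepsilon(\delta/|I|)^{-\gamma-\varepsilon}$. The Assouad spectrum is, for $0\le\theta<1$, $$\dim_{A,\theta}(E)=\limsup_{\delta\to0}\ \sup_{I:\,|I|=\delta^\theta}\frac{\log N(E\cap I,\delta)}{\log(|I|/\delta)},$$ with $I$ ranging over subintervals of $[1,2]$. The set $E$ is Assouad regular if $\dim_{A,\theta}(E)=\dim_A(E)$ for all $1>\theta>1-\frac{\dim_M(E)}{\dim_A(E)}$. *)

theory Defs
  imports "HOL-Analysis.Analysis" "HOL-Probability.Essential_Supremum"
begin

text \<open>
  The normalized spherical measure on the unit sphere of a Euclidean space: the push-forward of the
  uniform probability measure on the unit ball under radial projection (polar coordinates). It is a
  Borel measure on the whole space, concentrated on \<open>sphere 0 1\<close>.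
\<close>

definition sphere_measure :: "'b::euclidean_space measure" where
  "sphere_measure = distr (uniform_measure lborel (ball 0 1)) borel (\<lambda>v. v /\<^sub>R norm v)"

text \<open>
  The product type \<open>'a \<times> 'a\<close> carries the Euclidean norm, so for \<open>'a = real^'n\<close> the measure below is the
  one on the sphere of dimension \<open>2 * CARD('n) - 1\<close>. A value of the supremum may be \<open>\<infinity>\<close>.
\<close>

definition spherical_average ::
    "real \<Rightarrow> ('a::euclidean_space \<Rightarrow> real) \<Rightarrow> ('a \<Rightarrow> real) \<Rightarrow> 'a \<Rightarrow> real" where
  "spherical_average t f g x =
     (LINT w|sphere_measure. f (x - t *\<^sub>R fst w) * g (x - t *\<^sub>R snd w))"

definition spherical_maximal ::
    "real set \<Rightarrow> ('a::euclidean_space \<Rightarrow> real) \<Rightarrow> ('a \<Rightarrow> real) \<Rightarrow> 'a \<Rightarrow> ennreal" where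
  "spherical_maximal E f g x = (SUP t\<in>E. ennreal \<bar>spherical_average t f g x\<bar>)"

definition epowr :: "ennreal \<Rightarrow> real \<Rightarrow> ennreal" where
  "epowr u s = (if u = \<infinity> then \<infinity> else ennreal (enn2real u powr s))"

text \<open>The reciprocal of a Lebesgue exponent in \<open>(0, \<infinity>]\<close>, with \<open>1/\<infinity> = 0\<close>.\<close>

definition recip :: "ennreal \<Rightarrow> real" where
  "recip p = enn2real (inverse p)"

text \<open>
  The \<open>L\<^sup>p\<close> (quasi-)norm, \<open>0 < p \<le> \<infinity>\<close>, of a function given by its absolute value. Lebesgue measure is
  used in its completed form, so that modification on a null set is harmless.
\<close>

definition Lp_norm :: "ennreal \<Rightarrow> ('a::euclidean_space \<Rightarrow> ennreal) \<Rightarrow> ennreal" where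
  "Lp_norm p h =
     (if p = \<infinity> then esssup lebesgue h
      else epowr (\<integral>\<^sup>+x. epowr (h x) (enn2real p) \<partial>lebesgue) (recip p))"

text \<open>
  Each class in \<open>L\<^sup>p\<close> is represented by a Borel function; in dimension at least two the averages
  do not depend on the choice of the representative.
\<close>

definition Lp_fun :: "ennreal \<Rightarrow> ('a::euclidean_space \<Rightarrow> real) set" where
  "Lp_fun p = {f \<in> borel_measurable borel. Lp_norm p (\<lambda>x. ennreal \<bar>f x\<bar>) < \<infinity>}"

definition spherical_maximal_bounded ::
    "'a::euclidean_space itself \<Rightarrow> real set \<Rightarrow> ennreal \<Rightarrow> ennreal \<Rightarrow> ennreal \<Rightarrow> bool" where
  "spherical_maximal_bounded _ E p q r \<longleftrightarrow>
     (\<exists>C::real. \<forall>f\<in>Lp_fun p. \<forall>g\<in>Lp_fun q.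
        Lp_norm r (spherical_maximal E f g :: 'a \<Rightarrow> ennreal)
          \<le> ennreal C * Lp_norm p (\<lambda>x. ennreal \<bar>f x\<bar>) * Lp_norm q (\<lambda>x. ennreal \<bar>g x\<bar>))"

definition covering_number :: "real set \<Rightarrow> real \<Rightarrow> nat" where
  "covering_number F \<delta> = (LEAST n. \<exists>A. finite A \<and> card A = n \<and> F \<subseteq> (\<Union>a\<in>A. {a..a + \<delta>}))"

definition minkowski_dim :: "real set \<Rightarrow> ereal" where
  "minkowski_dim E =
     Limsup (at_right 0) (\<lambda>\<delta>. ereal (ln (real (covering_number E \<delta>)) / ln (1 / \<delta>)))"

text \<open>
  In the next two definitions it suffices to let \<open>I\<close> range over closed intervals, since passing to
  the closure preserves \<open>\<bar>I\<bar>\<close> and does not decrease \<open>N(E \<inter> I, \<delta>)\<close>. The infimum is attained.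
\<close>

definition assouad_dim :: "real set \<Rightarrow> ereal" where
  "assouad_dim E = Inf (ereal ` {\<gamma>. \<gamma> \<ge> 0 \<and>
     (\<exists>\<delta>\<^sub>0>0. \<forall>\<epsilon>>0. \<exists>C>0. \<forall>\<delta> a b.
        0 < \<delta> \<and> \<delta> < \<delta>\<^sub>0 \<and> 1 \<le> a \<and> b \<le> 2 \<and> \<delta> < b - a \<and> b - a < \<delta>\<^sub>0 \<longrightarrow>
        real (covering_number (E \<inter> {a..b}) \<delta>) \<le> C * (\<delta> / (b - a)) powr (- \<gamma> - \<epsilon>))})"

text \<open>
  When \<open>E \<inter> I\<close> is empty, \<open>ln 0 = 0\<close> here instead of \<open>-\<infinity>\<close>; for nonempty \<open>E \<subseteq> {1..2}\<close> this does not
  affect the supremum, which is nonnegative as some \<open>I\<close> of the given length meets \<open>E\<close>.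
\<close>

definition assouad_spectrum :: "real \<Rightarrow> real set \<Rightarrow> ereal" where
  "assouad_spectrum \<theta> E =
     Limsup (at_right 0) (\<lambda>\<delta>.
       SUP (a, b) \<in> {(a, b). 1 \<le> a \<and> a \<le> b \<and> b \<le> 2 \<and> b - a = \<delta> powr \<theta>}.
         ereal (ln (real (covering_number (E \<inter> {a..b}) \<delta>)) / ln ((b - a) / \<delta>)))"

definition assouad_regular :: "real set \<Rightarrow> bool" where
  "assouad_regular E \<longleftrightarrow>
     (\<forall>\<theta>. 0 \<le> \<theta> \<and> \<theta> < 1 \<and> 1 - minkowski_dim E / assouad_dim E < ereal \<theta> \<longrightarrow>
        assouad_spectrum \<theta> E = assouad_dim E)"

definition m_linear :: "nat \<Rightarrow> ennreal \<Rightarrow> real \<Rightarrow> real \<Rightarrow> real" where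
  "m_linear d r \<beta> \<gamma> = Min {
     (real d - 1) / real d + (1 - \<beta>) / real d * recip r,
     \<beta> * (real d - 1) / (\<beta> * (real d - 1) + 2 * \<gamma>)
       + ((real d - \<beta>) * 2 * \<gamma> - (real d - 1) * \<beta>) / (\<beta> * (real d - 1) + 2 * \<gamma>) * recip r,
     real d * recip r}"

end

theory Submission
  imports Defs "HOL-Real_Asymp.Real_Asymp"
begin

text \<open>
  Test the inequality on \<open>f = g = \<one>\<^sub>F\<close>: if every \<open>x \<in> H\<close> admits \<open>t \<in> E\<close> such that the set of directions
  \<open>(y, z)\<close> with \<open>x - t y, x - t z \<in> F\<close> has measure at least \<open>c\<close>, then \<open>c \<bar>H\<bar>\<^bsup>1/r\<^esup> \<le> C \<bar>F\<bar>\<^bsup>1/p + 1/q\<^esup>\<close>.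

  Large balls give \<open>1/r \<le> 1/p + 1/q\<close>. For \<open>F\<close> a ball of radius of order \<open>\<delta>\<close> and \<open>H\<close> the union of the annuli of width
  of order \<open>\<delta>\<close> and radii \<open>t/\<surd>2\<close>, \<open>t \<in> E\<close>, one has \<open>c \<sim> \<delta>\<^bsup>2d - 1\<^esup>\<close> and \<open>\<bar>H\<bar> \<sim> \<delta> N(E, \<delta>)\<close>; this is the first term of the
  minimum. The other two come from a Knapp type example: let \<open>I = [t0, t0 + L]\<close>, \<open>\<delta> = a\<^sup>2 L\<close>, let \<open>F\<close> be the
  \<open>\<delta>\<close>-neighbourhood of a cap of width \<open>a\<close> of the sphere of radius \<open>t0/\<surd>2\<close>, and let \<open>H\<close> consist of the \<open>x\<close> whose component
  along the axis is within \<open>\<delta>\<close> of \<open>(t - t0)/\<surd>2\<close> for some \<open>t \<in> E \<inter> I\<close> and whose orthogonal component is at most \<open>a L\<close>. Then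
  \<open>c \<sim> a\<^bsup>2(d - 1)\<^esup> \<delta>\<close>, \<open>\<bar>F\<bar> \<sim> a\<^bsup>d - 1\<^esup> \<delta>\<close> and \<open>\<bar>H\<bar> \<sim> (a L)\<^bsup>d - 1\<^esup> \<delta> N(E \<inter> I, \<delta>)\<close>. The choice \<open>L = \<delta>\<close> gives the third term, and
  \<open>L = \<delta>\<^sup>\<theta>\<close> with \<open>\<theta>\<close> decreasing to \<open>1 - \<beta>/\<gamma>\<close> gives the second one, since there the Assouad spectrum equals \<open>\<gamma>\<close>.
\<close>

section \<open>Testing on indicator functions\<close>

lemma recip_top [simp]: "recip top = 0"
  by (simp add: recip_def)

lemma recip_nonneg [simp]: "0 \<le> recip p"
  by (simp add: recip_def)

lemma recip_enn2real:
  assumes "p \<noteq> \<infinity>" "0 < p"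
  shows "recip p = 1 / enn2real p" "enn2real p > 0"
proof -
  obtain x where x: "p = ennreal x" "x > 0"
    using assms by (cases p) (auto simp: less_le)
  then show "recip p = 1 / enn2real p" "enn2real p > 0"
    by (simp_all add: recip_def inverse_ennreal divide_inverse)
qed

lemma epowr_ennreal: "0 \<le> x \<Longrightarrow> epowr (ennreal x) s = ennreal (x powr s)"
  by (simp add: epowr_def)

lemma epowr_mono:
  assumes "u \<le> v" "0 \<le> s"
  shows "epowr u s \<le> epowr v s"
proof (cases v)
  case (real y)
  then obtain x where x: "u = ennreal x" "0 \<le> x"
    using assms(1) by (cases u) (auto simp: top_unique)
  with real assms show ?thesis
    by (auto simp: epowr_ennreal intro!: ennreal_leI powr_mono2)
qed (auto simp: epowr_def)

text \<open>An upper bound \<open>c\<close> for the measure is all that the examples supply. It has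
  to be positive: for \<open>p = \<infinity>\<close> the right-hand side is \<open>c powr 0\<close>,
  and \<open>0 powr 0 = 0\<close>.\<close>

lemma Lp_norm_indicator_le:
  fixes F :: "'a::euclidean_space set"
  assumes F: "F \<in> sets borel" "emeasure lborel F \<le> ennreal c" and "c > 0" and "0 < p"
  shows "Lp_norm p (\<lambda>x. ennreal \<bar>indicat_real F x\<bar>) \<le> ennreal (c powr recip p)"
proof (cases "p = \<infinity>")
  case True
  have m: "(\<lambda>x. ennreal \<bar>indicat_real F x\<bar>) \<in> borel_measurable lebesgue"
    using F by (intro measurable_completion) auto
  have "esssup lebesgue (\<lambda>x. ennreal \<bar>indicat_real F x\<bar>) \<le> 1"
    by (rule esssup_I[OF m]) (auto simp: indicator_def)
  with True \<open>c > 0\<close> show ?thesis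
    by (simp add: Lp_norm_def)
next
  case False
  note p = recip_enn2real[OF False \<open>0 < p\<close>]
  have "epowr (ennreal \<bar>indicat_real F x\<bar>) (enn2real p) = indicator F x" for x
    using p by (simp add: epowr_ennreal indicator_def)
  then have "Lp_norm p (\<lambda>x. ennreal \<bar>indicat_real F x\<bar>) = epowr (emeasure lborel F) (recip p)"
    using False F(1) by (simp add: Lp_norm_def nn_integral_completion)
  also have "\<dots> \<le> epowr (ennreal c) (recip p)"
    using F(2) by (rule epowr_mono) simp
  finally show ?thesis
    using \<open>c > 0\<close> by (simp add: epowr_ennreal)
qed

text \<open>Chebyshev's inequality in the form needed for the maximal function. No measurability of
  \<open>u\<close> is assumed, since \<open>u\<close> will be a supremum over a possibly uncountable
  \<open>E\<close>; \<open>esssup_AE\<close> and monotonicity of the integral hold for arbitrary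
  functions.\<close>

lemma Lp_norm_ge:
  fixes H :: "'a::euclidean_space set"
  assumes H: "H \<in> sets borel" "ennreal h \<le> emeasure lborel H" and "h > 0" "c \<ge> 0" and "0 < r"
    and u: "\<And>x. x \<in> H \<Longrightarrow> ennreal c \<le> u x"
  shows "ennreal (c * h powr recip r) \<le> Lp_norm r u"
proof (cases "r = \<infinity>")
  case True
  have "ennreal c \<le> esssup lebesgue u"
  proof (rule ccontr)
    assume "\<not> ?thesis"
    then have "AE x in lebesgue. x \<notin> H"
      using esssup_AE[of u lebesgue] u by (auto elim!: eventually_mono dest: order.trans)
    then have "emeasure lebesgue H = 0"
      using H(1) by (subst (asm) AE_iff_null_sets[symmetric]) (auto simp: null_sets_def)
    with H \<open>h > 0\<close> show False by simp
  qed
  with True \<open>h > 0\<close> show ?thesis by (simp add: Lp_norm_def)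
next
  case False
  note p = recip_enn2real[OF False \<open>0 < r\<close>]
  let ?q = "enn2real r"
  have "ennreal (c powr ?q) * ennreal h \<le> ennreal (c powr ?q) * emeasure lborel H"
    using H by (intro mult_left_mono) auto
  also have "\<dots> = (\<integral>\<^sup>+x. ennreal (c powr ?q) * indicator H x \<partial>lebesgue)"
    using H by (simp add: nn_integral_completion nn_integral_cmult_indicator)
  also have "\<dots> \<le> (\<integral>\<^sup>+x. epowr (u x) ?q \<partial>lebesgue)"
    using epowr_mono[OF u, of _ ?q] p(2) \<open>c \<ge> 0\<close>
    by (intro nn_integral_mono) (auto simp: indicator_def epowr_ennreal)
  finally have "epowr (ennreal (c powr ?q) * ennreal h) (recip r) \<le> Lp_norm r u"
    using False by (simp add: Lp_norm_def epowr_mono)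
  moreover have "epowr (ennreal (c powr ?q) * ennreal h) (recip r) = ennreal (c * h powr recip r)"
    using \<open>h > 0\<close> \<open>c \<ge> 0\<close> p
    by (simp add: ennreal_mult[symmetric] epowr_ennreal powr_mult powr_powr)
  ultimately show ?thesis by simp
qed

section \<open>Spherical measure and averages of indicator functions\<close>

lemma sets_sphere_measure [measurable_cong, simp]: "sets sphere_measure = sets borel"
  by (simp add: sphere_measure_def)

lemma space_sphere_measure [simp]: "space sphere_measure = UNIV"
  by (simp add: sphere_measure_def)

text \<open>Reduces measures on the sphere to volumes of radial sets in the solid ball, where Fubini
  applies to the two components.\<close>

lemma emeasure_sphere_measure:
  fixes W :: "'b::euclidean_space set"
  assumes W[measurable]: "W \<in> sets borel"
  shows "emeasure sphere_measure W =
    emeasure lborel {v \<in> ball 0 1. v /\<^sub>R norm v \<in> W} / emeasure lborel (ball (0::'b) 1)"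
proof -
  have "emeasure sphere_measure W =
    emeasure (uniform_measure lborel (ball 0 1)) {v::'b. v /\<^sub>R norm v \<in> W}"
    unfolding sphere_measure_def by (subst emeasure_distr) (auto simp: vimage_def)
  also have "\<dots> = emeasure lborel (ball 0 1 \<inter> {v::'b. v /\<^sub>R norm v \<in> W}) / emeasure lborel (ball (0::'b) 1)"
    by (rule emeasure_uniform_measure) (simp, measurable)
  finally show ?thesis by (simp add: Int_def)
qed

lemma emeasure_ball_finite_pos:
  "emeasure lborel (ball (0::'b::euclidean_space) 1) \<noteq> 0" "emeasure lborel (ball (0::'b) 1) \<noteq> \<infinity>"
  by (simp_all add: emeasure_ball ennreal_eq_0_iff not_le)

lemma emeasure_sphere_measure_UNIV [simp]:
  "emeasure (sphere_measure :: 'b::euclidean_space measure) UNIV = 1"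
  using emeasure_ball_finite_pos[where 'b='b]
  by (simp add: emeasure_sphere_measure ennreal_divide_self less_top ball_def)

lemma finite_measure_sphere_measure: "finite_measure (sphere_measure :: 'b::euclidean_space measure)"
  by (rule finite_measureI) simp

lemma measurable_fst_borel [measurable]: "fst \<in> borel_measurable (borel :: ('a::euclidean_space \<times> 'b::euclidean_space) measure)"
  and measurable_snd_borel [measurable]: "snd \<in> borel_measurable (borel :: ('a::euclidean_space \<times> 'b::euclidean_space) measure)"
  by (auto intro!: borel_measurable_continuous_onI continuous_intros)

lemma spherical_average_indicator:
  fixes F :: "'a::euclidean_space set"
  assumes [measurable]: "F \<in> sets borel"
  shows "spherical_average t (indicat_real F) (indicat_real F) x =
    measure sphere_measure {w. x - t *\<^sub>R fst w \<in> F \<and> x - t *\<^sub>R snd w \<in> F}"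
proof -
  have "{w::'a \<times> 'a. x - t *\<^sub>R fst w \<in> F \<and> x - t *\<^sub>R snd w \<in> F} \<in> sets borel"
    by measurable
  moreover have "indicat_real F (x - t *\<^sub>R fst w) * indicat_real F (x - t *\<^sub>R snd w) =
     indicat_real {w::'a \<times> 'a. x - t *\<^sub>R fst w \<in> F \<and> x - t *\<^sub>R snd w \<in> F} w" for w
    by (auto simp: indicator_def)
  ultimately show ?thesis
    unfolding spherical_average_def by simp
qed

text \<open>The testing principle behind all examples. It asks only for one-sided bounds on the
  volumes and on the averages, so no quantity has to be computed exactly.\<close>

lemma spherical_maximal_bounded_indicatorE:
  assumes "spherical_maximal_bounded TYPE('a::euclidean_space) E p q r" "0 < p" "0 < q" "0 < r"
  obtains C :: real where "C > 0" and
    "\<And>(F::'a set) H f h c. F \<in> sets borel \<Longrightarrow> H \<in> sets borel \<Longrightarrow>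
      emeasure lborel F \<le> ennreal f \<Longrightarrow> ennreal h \<le> emeasure lborel H \<Longrightarrow> f > 0 \<Longrightarrow> h > 0 \<Longrightarrow> c \<ge> 0 \<Longrightarrow>
      (\<And>x. x \<in> H \<Longrightarrow> \<exists>t\<in>E. c \<le> measure sphere_measure {w. x - t *\<^sub>R fst w \<in> F \<and> x - t *\<^sub>R snd w \<in> F}) \<Longrightarrow>
      c * h powr recip r \<le> C * f powr (recip p + recip q)"
proof -
  from assms(1) obtain C :: real where C: "\<And>f g. f \<in> Lp_fun p \<Longrightarrow> g \<in> Lp_fun q \<Longrightarrow>
      Lp_norm r (spherical_maximal E f g :: 'a \<Rightarrow> ennreal)
          \<le> ennreal C * Lp_norm p (\<lambda>x. ennreal \<bar>f x\<bar>) * Lp_norm q (\<lambda>x. ennreal \<bar>g x\<bar>)"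
    unfolding spherical_maximal_bounded_def by blast
  show thesis
  \<comment> \<open>The constant from the definition of boundedness need not be positive.\<close>
  proof (rule that[of "max C 1"])
    fix F H :: "'a set" and f h c :: real
    assume F: "F \<in> sets borel" and H: "H \<in> sets borel" and f: "emeasure lborel F \<le> ennreal f"
      and h: "ennreal h \<le> emeasure lborel H" and pos: "f > 0" "h > 0" "c \<ge> 0"
      and avg: "\<And>x. x \<in> H \<Longrightarrow> \<exists>t\<in>E. c \<le> measure sphere_measure {w. x - t *\<^sub>R fst w \<in> F \<and> x - t *\<^sub>R snd w \<in> F}"
    note Fp = Lp_norm_indicator_le[OF F f pos(1) \<open>0 < p\<close>] and Fq = Lp_norm_indicator_le[OF F f pos(1) \<open>0 < q\<close>]
    have "indicat_real F \<in> Lp_fun p" "indicat_real F \<in> Lp_fun q"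
      using F Fp Fq by (auto simp: Lp_fun_def intro: le_less_trans[OF _ ennreal_less_top])
    note CF = C[OF this]
    have "ennreal c \<le> spherical_maximal E (indicat_real F) (indicat_real F) x" if x: "x \<in> H" for x
    proof -
      obtain t where t: "t \<in> E" "c \<le> spherical_average t (indicat_real F) (indicat_real F) x"
        using avg[OF x] spherical_average_indicator[OF F] by auto
      have "ennreal c \<le> ennreal \<bar>spherical_average t (indicat_real F) (indicat_real F) x\<bar>"
        using t by (intro ennreal_leI) auto
      then show ?thesis
        unfolding spherical_maximal_def using t(1) by (rule SUP_upper2[rotated])
    qed
    then have "ennreal (c * h powr recip r) \<le> Lp_norm r (spherical_maximal E (indicat_real F) (indicat_real F))"
      using Lp_norm_ge[OF H h pos(2,3) \<open>0 < r\<close>] by blast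
    also note CF
    also have "ennreal C * Lp_norm p (\<lambda>x. ennreal \<bar>indicat_real F x\<bar>) * Lp_norm q (\<lambda>x. ennreal \<bar>indicat_real F x\<bar>)
       \<le> ennreal (max C 1) * ennreal (f powr recip p) * ennreal (f powr recip q)"
      using Fp Fq by (intro mult_mono ennreal_leI) auto
    also have "\<dots> = ennreal (max C 1 * f powr (recip p + recip q))"
      by (simp add: ennreal_mult powr_add mult.assoc)
    finally show "c * h powr recip r \<le> max C 1 * f powr (recip p + recip q)"
      by (subst (asm) ennreal_le_iff) auto
  qed simp
qed

section \<open>Volumes of cones\<close>

text \<open>For \<open>a > 0\<close> the right-hand side forces
  \<open>z \<bullet> e \<ge> 0\<close>, so this is one nappe around the ray through
  \<open>e\<close>, with slope \<open>a\<close> in place of an angle. Invariance under positive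
  scaling makes it compatible with radial projection; intersected with a sphere it is a cap of width
  about \<open>a\<close>.\<close>

definition axial_cone :: "'a::euclidean_space \<Rightarrow> real \<Rightarrow> 'a set" where
  "axial_cone e a = {z. norm (z - (z \<bullet> e) *\<^sub>R e) \<le> a * (z \<bullet> e)}"

abbreviation cone_vol :: "'a::euclidean_space \<Rightarrow> real \<Rightarrow> real" where
  "cone_vol e a \<equiv> measure lborel (axial_cone e a \<inter> cball 0 1)"

lemma axial_cone_borel [measurable, simp]: "axial_cone e a \<in> sets borel"
  unfolding axial_cone_def by (auto intro!: borel_closed closed_Collect_le continuous_intros)

lemma scaleR_axial_cone_iff:
  assumes "c > 0"
  shows "c *\<^sub>R z \<in> axial_cone e a \<longleftrightarrow> z \<in> axial_cone e a"
proof -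
  have "c *\<^sub>R z - (c *\<^sub>R z \<bullet> e) *\<^sub>R e = c *\<^sub>R (z - (z \<bullet> e) *\<^sub>R e)"
    by (simp add: algebra_simps)
  then have "norm (c *\<^sub>R z - (c *\<^sub>R z \<bullet> e) *\<^sub>R e) = c * norm (z - (z \<bullet> e) *\<^sub>R e)"
    using assms by (simp only: norm_scaleR)
  then show ?thesis
    using assms mult_le_cancel_left_pos[of c "norm (z - (z \<bullet> e) *\<^sub>R e)" "a * (z \<bullet> e)"]
    by (simp add: axial_cone_def ac_simps)
qed

lemma emeasure_cone_cball_finite: "emeasure lborel (axial_cone e a \<inter> cball 0 r) \<noteq> top"
  using emeasure_mono[of "axial_cone e a \<inter> cball 0 r" "cball 0 r" lborel]
    emeasure_lborel_cball_finite[of 0 r] unfolding less_top infinity_ennreal_def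
  by (auto intro: le_less_trans)

lemma emeasure_cone_cball:
  fixes e :: "'a::euclidean_space"
  assumes "0 \<le> r"
  shows "emeasure lborel (axial_cone e a \<inter> cball 0 r) = ennreal (r ^ DIM('a) * cone_vol e a)"
proof (cases "r = 0")
  case True
  have "emeasure lborel (axial_cone e a \<inter> cball 0 0) \<le> emeasure lborel {0::'a}"
    by (intro emeasure_mono) auto
  with True show ?thesis by simp
next
  case False
  with assms have r: "r > 0" by simp
  have "axial_cone e a \<inter> cball 0 r = (\<lambda>x. r *\<^sub>R x + 0) ` (axial_cone e a \<inter> cball 0 1)"
  proof safe
    fix z assume z: "z \<in> axial_cone e a" "z \<in> cball 0 r"
    show "z \<in> (\<lambda>x. r *\<^sub>R x + 0) ` (axial_cone e a \<inter> cball 0 1)"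
      using z r scaleR_axial_cone_iff[of "1 / r" z e a]
      by (intro image_eqI[of _ _ "(1 / r) *\<^sub>R z"]) (auto simp: field_simps)
  qed (use r in \<open>auto simp: scaleR_axial_cone_iff mult_left_le\<close>)
  then have "emeasure lebesgue (axial_cone e a \<inter> cball 0 r) =
      ennreal (r ^ DIM('a)) * emeasure lebesgue (axial_cone e a \<inter> cball 0 1)"
    using r by (simp only: emeasure_lebesgue_affine) (simp add: ennreal_power)
  then show ?thesis
    using r emeasure_eq_ennreal_measure[OF emeasure_cone_cball_finite[of e a 1]]
    by (simp add: ennreal_mult)
qed

text \<open>A shell of the cone is a difference of two dilates of the same truncated cone, which
  replaces integration in polar coordinates.\<close>

lemma emeasure_cone_shell:
  fixes e :: "'a::euclidean_space"
  assumes "0 \<le> r" "r \<le> R"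
  shows "emeasure lborel {z \<in> axial_cone e a. r < norm z \<and> norm z \<le> R} =
    ennreal ((R ^ DIM('a) - r ^ DIM('a)) * cone_vol e a)"
proof -
  have "{z \<in> axial_cone e a. r < norm z \<and> norm z \<le> R} =
    (axial_cone e a \<inter> cball 0 R) - (axial_cone e a \<inter> cball 0 r)"
    by auto
  moreover have "emeasure lborel ((axial_cone e a \<inter> cball 0 R) - (axial_cone e a \<inter> cball 0 r)) =
     emeasure lborel (axial_cone e a \<inter> cball 0 R) - emeasure lborel (axial_cone e a \<inter> cball 0 r)"
    using assms emeasure_cone_cball_finite[of e a r] by (intro emeasure_Diff) auto
  ultimately show ?thesis
    using assms by (simp add: emeasure_cone_cball ennreal_minus power_mono left_diff_distrib)
qed

section \<open>Two-sided bounds for the volume of a narrow cone and for powers of radii\<close>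

lemma nat_floor_inverse_bounds:
  assumes "0 < (a::real)" "a \<le> 1"
  shows "1 / (2 * a) \<le> real (nat \<lfloor>1 / a\<rfloor>)" "real (nat \<lfloor>1 / a\<rfloor>) \<le> 1 / a"
proof -
  have "1 \<le> 1 / a" using assms by simp
  then have fl: "1 \<le> \<lfloor>1 / a\<rfloor>" by (simp add: le_floor_iff)
  then have "real (nat \<lfloor>1 / a\<rfloor>) = of_int \<lfloor>1 / a\<rfloor>" by (intro of_nat_nat) linarith
  moreover have "1 / a < of_int \<lfloor>1 / a\<rfloor> + 1" by linarith
  moreover have "(1::real) \<le> of_int \<lfloor>1 / a\<rfloor>" using fl by linarith
  ultimately have "1 / a \<le> 2 * real (nat \<lfloor>1 / a\<rfloor>)" by linarith
  then show "1 / (2 * a) \<le> real (nat \<lfloor>1 / a\<rfloor>)" using assms by (simp add: field_simps)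
  show "real (nat \<lfloor>1 / a\<rfloor>) \<le> 1 / a"
    using assms by (simp add: of_nat_nat)
qed

lemma power_DIM: "(x::real) ^ DIM('a::euclidean_space) = x * x ^ (DIM('a) - 1)"
  by (simp add: power_eq_if)

text \<open>The cone contains about \<open>1/a\<close> disjoint balls of radius about \<open>a\<close> centred on its axis.\<close>

lemma cone_vol_ge:
  fixes e :: "'a::euclidean_space"
  assumes e: "norm e = 1" and a: "0 < a" "a \<le> 1"
  shows "unit_ball_vol DIM('a) / (2 * 8 ^ DIM('a)) * a ^ (DIM('a) - 1) \<le> cone_vol e a"
proof -
  define n where "n = nat \<lfloor>1 / a\<rfloor>"
  \<comment> \<open>The spacing a/4 is twice the radius a/8, so the balls are disjoint. Heights
    between 1/2 and 3/4 leave room for the radius inside both the cone and the unit ball.\<close>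
  define c where "c k = (1 / 2 + real k * a / 4) *\<^sub>R e" for k :: nat
  have ee: "e \<bullet> e = 1" using e by (simp add: norm_eq_1)
  have n: "1 / (2 * a) \<le> real n" "real n \<le> 1 / a"
    unfolding n_def by (rule nat_floor_inverse_bounds[OF a])+
  have na: "real n * a \<le> 1" using n(2) a by (simp add: pos_le_divide_eq)
  have sub: "ball (c k) (a / 8) \<subseteq> axial_cone e a \<inter> cball 0 1" if k: "k < n" for k
  proof
    fix z assume "z \<in> ball (c k) (a / 8)"
    then have w: "norm (z - c k) < a / 8" by (simp add: dist_norm norm_minus_commute)
    define s where "s = 1 / 2 + real k * a / 4"
    have "real k * a \<le> real n * a" using k a by (intro mult_right_mono) auto
    with na have "real k * a \<le> 1" by linarith
    then have s: "1 / 2 \<le> s" "s \<le> 3 / 4" using a by (auto simp: s_def)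
    define w' where "w' = z - c k"
    have w: "norm w' < a / 8" using w by (simp add: w'_def)
    have z: "z = s *\<^sub>R e + w'" by (simp add: w'_def s_def c_def)
    have we: "\<bar>w' \<bullet> e\<bar> \<le> norm w'" using Cauchy_Schwarz_ineq2[of w' e] e by simp
    have "z - (z \<bullet> e) *\<^sub>R e = w' - (w' \<bullet> e) *\<^sub>R e"
      by (simp add: z ee algebra_simps)
    also have "norm \<dots> \<le> norm w' + \<bar>w' \<bullet> e\<bar>"
      using norm_triangle_ineq4[of w' "(w' \<bullet> e) *\<^sub>R e"] e by simp
    also have "\<dots> \<le> a * (1 / 4)" using we w by simp
    also have "\<dots> \<le> a * (z \<bullet> e)"
      using we w s a by (intro mult_left_mono) (auto simp: z ee inner_add_left)
    finally have "z \<in> axial_cone e a" by (simp add: axial_cone_def)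
    moreover have "norm z \<le> s + norm w'"
      using norm_triangle_ineq[of "s *\<^sub>R e" w'] e s by (simp add: z)
    ultimately show "z \<in> axial_cone e a \<inter> cball 0 1"
      using s w a by simp
  qed
  have disj: "disjoint_family_on (\<lambda>k. ball (c k) (a / 8)) {..<n}"
    unfolding disjoint_family_on_def
  proof (intro ballI impI)
    fix i j :: nat assume "i \<noteq> j"
    have "c i - c j = ((real i - real j) * a / 4) *\<^sub>R e"
      by (simp add: c_def algebra_simps add_divide_distrib diff_divide_distrib)
    then have "dist (c i) (c j) = \<bar>real i - real j\<bar> * a / 4"
      using e a by (simp add: dist_norm abs_mult)
    moreover have "1 \<le> \<bar>real i - real j\<bar>" using \<open>i \<noteq> j\<close> by linarith
    ultimately have "a / 4 \<le> dist (c i) (c j)"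
      using a mult_right_mono[of 1 "\<bar>real i - real j\<bar>" a] by simp
    then show "ball (c i) (a / 8) \<inter> ball (c j) (a / 8) = {}"
      by (intro disjoint_ballI) auto
  qed
  have "ennreal (unit_ball_vol DIM('a) / (2 * 8 ^ DIM('a)) * a ^ (DIM('a) - 1))
     = ennreal (1 / (2 * a) * (unit_ball_vol DIM('a) * (a / 8) ^ DIM('a)))"
    using a by (simp add: power_divide power_DIM[where 'a='a and x=a])
  also have "\<dots> \<le> ennreal (real n * (unit_ball_vol DIM('a) * (a / 8) ^ DIM('a)))"
    using n a by (intro ennreal_leI mult_right_mono) auto
  also have "\<dots> = (\<Sum>k<n. emeasure lborel (ball (c k) (a / 8)))"
    using a by (simp add: emeasure_ball ennreal_mult ennreal_of_nat_eq_real_of_nat)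
  also have "\<dots> = emeasure lborel (\<Union>k<n. ball (c k) (a / 8))"
    using disj by (intro sum_emeasure) auto
  also have "\<dots> \<le> emeasure lborel (axial_cone e a \<inter> cball 0 1)"
    using sub by (intro emeasure_mono) auto
  finally show ?thesis
    using emeasure_eq_ennreal_measure[OF emeasure_cone_cball_finite[of e a 1]]
    by (simp add: ennreal_le_iff)
qed

text \<open>At height \<open>s \<le> 1\<close> the cone has radius at most \<open>a\<close>, so the
  balls of radius \<open>2 * a\<close> centred at the multiples of \<open>a\<close> on the axis
  cover it. There are \<open>n + 1\<close> of them, at most (1 + a)/a; the factor
  \<open>1 + a\<close> is kept because the lemma will be applied with slopes larger than 1.\<close>

lemma cone_vol_le:
  fixes e :: "'a::euclidean_space"
  assumes e: "norm e = 1" and a: "0 < a"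
  shows "cone_vol e a \<le> unit_ball_vol DIM('a) * 2 ^ DIM('a) * (1 + a) * a ^ (DIM('a) - 1)"
proof -
  define n where "n = nat \<lfloor>1 / a\<rfloor>"
  have n: "real n + 1 \<le> (1 + a) / a"
    using a by (simp add: n_def of_nat_nat add_divide_distrib)
  have sub: "axial_cone e a \<inter> cball 0 1 \<subseteq> (\<Union>k\<le>n. ball ((real k * a) *\<^sub>R e) (2 * a))"
  proof
    fix z assume z: "z \<in> axial_cone e a \<inter> cball 0 1"
    define s where "s = z \<bullet> e"
    have z': "norm (z - s *\<^sub>R e) \<le> a * s" using z by (simp add: axial_cone_def s_def)
    have s0: "0 \<le> s" using order.trans[OF norm_ge_zero z'] a by (simp add: zero_le_mult_iff)
    have s1: "s \<le> 1" using z norm_cauchy_schwarz[of z e] e by (simp add: s_def)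
    define k where "k = nat \<lfloor>s / a\<rfloor>"
    have "real k \<le> s / a" "s / a < real k + 1"
      using s0 a by (auto simp: k_def of_nat_nat)
    then have ks: "real k * a \<le> s" "s < real k * a + a" using a by (auto simp: field_simps)
    have "k \<le> n"
      unfolding k_def n_def using s1 a by (intro nat_mono floor_mono divide_right_mono) auto
    have eq: "z - (real k * a) *\<^sub>R e = (z - s *\<^sub>R e) + (s - real k * a) *\<^sub>R e"
      by (simp add: algebra_simps)
    have "norm (z - (real k * a) *\<^sub>R e) \<le> norm (z - s *\<^sub>R e) + \<bar>s - real k * a\<bar>"
      unfolding eq using norm_triangle_ineq[of "z - s *\<^sub>R e" "(s - real k * a) *\<^sub>R e"] e by simp
    also have "\<dots> < a * s + a" using z' ks by simp
    also have "\<dots> \<le> 2 * a" using a s1 mult_left_mono[of s 1 a] by simp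
    finally show "z \<in> (\<Union>k\<le>n. ball ((real k * a) *\<^sub>R e) (2 * a))"
      using \<open>k \<le> n\<close> by (auto simp: dist_norm norm_minus_commute)
  qed
  have "emeasure lborel (axial_cone e a \<inter> cball 0 1)
      \<le> emeasure lborel (\<Union>k\<le>n. ball ((real k * a) *\<^sub>R e) (2 * a))"
    using sub by (intro emeasure_mono) auto
  also have "\<dots> \<le> (\<Sum>k\<le>n. emeasure lborel (ball ((real k * a) *\<^sub>R e) (2 * a)))"
    by (intro emeasure_subadditive_finite) auto
  also have "\<dots> = ennreal ((real n + 1) * (unit_ball_vol DIM('a) * (2 * a) ^ DIM('a)))"
    using a by (simp add: emeasure_ball ennreal_mult ennreal_of_nat_eq_real_of_nat add.commute
        flip: ennreal_1 ennreal_plus del: ennreal_1)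
  also have "\<dots> \<le> ennreal ((1 + a) / a * (unit_ball_vol DIM('a) * (2 * a) ^ DIM('a)))"
    using n a by (intro ennreal_leI mult_right_mono) auto
  also have "(1 + a) / a * (unit_ball_vol DIM('a) * (2 * a) ^ DIM('a)) =
     unit_ball_vol DIM('a) * 2 ^ DIM('a) * (1 + a) * a ^ (DIM('a) - 1)"
    using a by (simp add: power_mult_distrib power_DIM[where 'a='a and x=a])
  finally show ?thesis
    using emeasure_eq_ennreal_measure[OF emeasure_cone_cball_finite[of e a 1]] a
    by (simp add: ennreal_le_iff)
qed

text \<open>Together with \<open>power_diff_le\<close>, this compares the volume of a shell with its
  thickness times a power of the outer radius. Here one power of \<open>r\<close> is kept and the
  others are replaced by \<open>R\<close>.\<close>

lemma power_diff_ge: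
  fixes r R :: real
  assumes "0 \<le> r" "r \<le> R" "0 < n"
  shows "(R - r) * R ^ (n - 1) \<le> R ^ n - r ^ n"
proof -
  have "r * r ^ (n - 1) \<le> r * R ^ (n - 1)"
    using assms by (intro mult_left_mono power_mono) auto
  then show ?thesis using assms by (simp add: power_eq_if algebra_simps)
qed

lemma power_diff_le:
  fixes r R :: real
  assumes "0 \<le> r" "r \<le> R"
  shows "R ^ n - r ^ n \<le> real n * (R - r) * R ^ (n - 1)"
proof -
  have "(\<Sum>i<n. r ^ (n - Suc i) * R ^ i) \<le> (\<Sum>i<n. R ^ (n - 1))"
  proof (rule sum_mono)
    fix i assume i: "i \<in> {..<n}"
    have "r ^ (n - Suc i) * R ^ i \<le> R ^ (n - Suc i) * R ^ i"
      using assms by (intro mult_right_mono power_mono) auto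
    also have "\<dots> = R ^ (n - 1)" using i by (simp flip: power_add)
    finally show "r ^ (n - Suc i) * R ^ i \<le> R ^ (n - 1)" .
  qed
  then have "(R - r) * (\<Sum>i<n. r ^ (n - Suc i) * R ^ i) \<le> (R - r) * (\<Sum>i<n. R ^ (n - 1))"
    using assms by (intro mult_left_mono) auto
  then show ?thesis by (simp add: power_diff_sumr2 mult_ac)
qed

section \<open>Spherical measure of pairs of caps\<close>

text \<open>On the unit sphere of the product, components of equal norm have norm 1/sqrt 2. The
  trace of the patch on that sphere therefore consists of pairs of almost equal length, both
  pointing into the same cap.\<close>

definition cone_patch :: "'a::euclidean_space \<Rightarrow> real \<Rightarrow> real \<Rightarrow> ('a \<times> 'a) set" where
  "cone_patch e a \<eta> = {w. fst w \<in> axial_cone e a \<and> snd w \<in> axial_cone e a \<and>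
     \<bar>norm (fst w) - 1 / sqrt 2\<bar> \<le> \<eta> \<and> \<bar>norm (snd w) - 1 / sqrt 2\<bar> \<le> \<eta>}"

lemma cone_patch_borel [measurable, simp]: "cone_patch e a \<eta> \<in> sets borel"
  unfolding cone_patch_def by measurable

text \<open>Measures how far the component norms of a radially projected pair are from 1/sqrt 2.
  From \<open>n\<^sup>2 = y\<^sup>2 + z\<^sup>2\<close> one gets 2 y^2 - n^2 = y^2 - z^2; factoring
  both sides and using y + z \<le> sqrt 2 y + n gives the bound.\<close>

lemma abs_div_sqrt_sum_le:
  fixes y z n :: real
  assumes "0 \<le> y" "0 \<le> z" "0 < n" "n\<^sup>2 = y\<^sup>2 + z\<^sup>2"
  shows "\<bar>y / n - 1 / sqrt 2\<bar> \<le> \<bar>y - z\<bar> / n"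
proof -
  have *: "\<bar>sqrt 2 * y - n\<bar> \<le> \<bar>y - z\<bar>"
  proof -
    have "(sqrt 2 * y - n) * (sqrt 2 * y + n) = (y - z) * (y + z)"
      using assms(4) by (simp add: algebra_simps power2_eq_square)
    then have "\<bar>sqrt 2 * y - n\<bar> * \<bar>sqrt 2 * y + n\<bar> = \<bar>y - z\<bar> * \<bar>y + z\<bar>"
      by (metis abs_mult)
    moreover have p: "0 < sqrt 2 * y + n" using assms by (intro add_nonneg_pos) auto
    ultimately have eq: "\<bar>sqrt 2 * y - n\<bar> * (sqrt 2 * y + n) = \<bar>y - z\<bar> * (y + z)"
      using assms by simp
    have z: "z \<le> n" using assms by (intro power2_le_imp_le[of z n]) auto
    have y: "y \<le> sqrt 2 * y" using mult_right_mono[of 1 "sqrt 2" y] assms by simp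
    have "y + z \<le> sqrt 2 * y + n" using y z by linarith
    then have "\<bar>y - z\<bar> * (y + z) \<le> \<bar>y - z\<bar> * (sqrt 2 * y + n)" by (intro mult_left_mono) auto
    then show ?thesis
      unfolding eq[symmetric] using p by (rule mult_right_le_imp_le)
  qed
  have "y / n - 1 / sqrt 2 = (sqrt 2 * y - n) / (sqrt 2 * n)"
    using assms by (simp add: field_simps)
  then have "\<bar>y / n - 1 / sqrt 2\<bar> = \<bar>sqrt 2 * y - n\<bar> / (sqrt 2 * n)"
    using assms by (simp add: abs_mult)
  also have "\<dots> \<le> \<bar>y - z\<bar> / n"
    using * assms by (intro frac_le) auto
  finally show ?thesis .
qed

text \<open>Pairs in the solid ball whose components lie in the cone and have nearly equal norms
  project into the patch. By Fubini their volume is at least a constant times the square of the cone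
  volume times \<eta>, and \<open>cone_vol_ge\<close> supplies the power of \<open>a\<close>. The
  constant is independent of the axis.\<close>

lemma sphere_measure_cone_patch_ge:
  obtains \<kappa> :: real where "\<kappa> > 0" and
    "\<And>(e::'a::euclidean_space) a \<eta>. norm e = 1 \<Longrightarrow> 0 < a \<Longrightarrow> a \<le> 1 \<Longrightarrow> 0 < \<eta> \<Longrightarrow> \<eta> \<le> 1 / 4 \<Longrightarrow>
      \<kappa> * (a ^ (DIM('a) - 1))\<^sup>2 * \<eta> \<le> measure sphere_measure (cone_patch e a \<eta>)"
proof -
  define d where "d = DIM('a)"
  have d: "0 < d" by (simp add: d_def)
  define b where "b = measure lborel (ball (0::'a \<times> 'a) 1)"
  have b: "emeasure lborel (ball (0::'a \<times> 'a) 1) = ennreal b"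
    unfolding b_def using emeasure_ball_finite_pos(2)[where 'b="'a \<times> 'a"]
    by (simp add: emeasure_eq_ennreal_measure)
  then have b0: "b > 0"
    using emeasure_ball_finite_pos(1)[where 'b="'a \<times> 'a"] by (simp add: ennreal_eq_0_iff not_le)
  define v where "v = unit_ball_vol (real d) / (2 * 8 ^ d)"
  have v0: "v > 0" by (simp add: v_def)
  \<comment> \<open>The factors come from the slices of \<open>V\<close>, from the shell
    \<open>S\<close>, from the two uses of \<open>cone_vol_ge\<close>, and from the normalization by
    the volume of the unit ball.\<close>
  define \<kappa> where "\<kappa> = (1 / 4) * (1 / 4) ^ (d - 1) * (1 / 4) * (1 / 2) ^ (d - 1) * v\<^sup>2 / b"
  have k0: "\<kappa> > 0" using v0 b0 by (simp add: \<kappa>_def)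
  have "\<kappa> * (a ^ (DIM('a) - 1))\<^sup>2 * \<eta> \<le> measure sphere_measure (cone_patch e a \<eta>)"
    if e: "norm e = 1" and a: "0 < a" "a \<le> 1" and \<eta>: "0 < \<eta>" "\<eta> \<le> 1 / 4" for e :: 'a and a \<eta>
  proof -
    let ?K = "axial_cone e a"
    define c where "c = cone_vol e a"
    have c: "v * a ^ (d - 1) \<le> c" unfolding c_def v_def d_def by (rule cone_vol_ge[OF e a])
    have c0: "0 \<le> c" by (simp add: c_def)
    define S where "S = {y \<in> ?K. 1 / 4 < norm y \<and> norm y \<le> 1 / 2}"
    \<comment> \<open>Norms above 1/4 turn the gap \<eta>/4 into at most \<eta> after normalization;
      norms of at most 1/2 and 9/16 keep the pair inside the unit ball.\<close>
    define V where "V = {w. fst w \<in> S \<and> snd w \<in> ?K \<and> norm (fst w) < norm (snd w) \<and>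
       norm (snd w) \<le> norm (fst w) + \<eta> / 4}"
    have [measurable]: "S \<in> sets borel" unfolding S_def by measurable
    have [measurable]: "V \<in> sets borel" unfolding V_def by measurable
    have sub: "V \<subseteq> {w \<in> ball 0 1. w /\<^sub>R norm w \<in> cone_patch e a \<eta>}"
    proof
      fix w assume w: "w \<in> V"
      define y z n where "y = norm (fst w)" and "z = norm (snd w)" and "n = norm w"
      have yz: "1 / 4 < y" "y \<le> 1 / 2" "y < z" "z \<le> y + \<eta> / 4"
        using w by (auto simp: V_def S_def y_def z_def)
      have n2: "n\<^sup>2 = y\<^sup>2 + z\<^sup>2" by (simp add: n_def y_def z_def norm_prod_def)
      have yn: "y \<le> n" unfolding y_def n_def using norm_fst_le[of "fst w" "snd w"] by simp
      have n0: "1 / 4 < n" using yn yz by linarith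
      have "y\<^sup>2 \<le> (1 / 2)\<^sup>2" "z\<^sup>2 \<le> (9 / 16)\<^sup>2" using yz \<eta> by (auto intro!: power_mono)
      then have "n\<^sup>2 < 1\<^sup>2" unfolding n2 by (simp add: power2_eq_square)
      then have n1: "n < 1" by (rule power2_less_imp_less) simp
      have dn: "\<bar>y - z\<bar> / n \<le> \<eta>"
      proof -
        have "\<bar>y - z\<bar> / n \<le> (\<eta> / 4) / (1 / 4)"
          using yz n0 by (intro frac_le) auto
        then show ?thesis by simp
      qed
      have "\<bar>y / n - 1 / sqrt 2\<bar> \<le> \<eta>" "\<bar>z / n - 1 / sqrt 2\<bar> \<le> \<eta>"
        using abs_div_sqrt_sum_le[of y z n] abs_div_sqrt_sum_le[of z y n] yz n0 n2 dn
        by (auto simp: abs_minus_commute add.commute)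
      moreover have "norm (fst (w /\<^sub>R n)) = y / n" "norm (snd (w /\<^sub>R n)) = z / n"
        using n0 by (simp_all add: y_def z_def field_simps)
      moreover have "fst (w /\<^sub>R n) \<in> ?K" "snd (w /\<^sub>R n) \<in> ?K"
        using w n0 by (simp_all add: V_def S_def scaleR_axial_cone_iff)
      ultimately have "w /\<^sub>R n \<in> cone_patch e a \<eta>" by (simp add: cone_patch_def)
      then show "w \<in> {w \<in> ball 0 1. w /\<^sub>R norm w \<in> cone_patch e a \<eta>}"
        using n1 by (simp add: n_def)
    qed
    \<comment> \<open>Each slice over \<open>S\<close> is a cone shell of thickness \<eta>/4 and
      inner radius above 1/4, which gives a bound independent of \<open>y\<close>.\<close>
    have fib: "ennreal (\<eta> / 4 * (1 / 4) ^ (d - 1) * c) * indicator S y \<le> emeasure lborel (Pair y -` V)" for y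
    proof (cases "y \<in> S")
      case True
      then have y: "1 / 4 < norm y" by (simp add: S_def)
      have "Pair y -` V = {z \<in> ?K. norm y < norm z \<and> norm z \<le> norm y + \<eta> / 4}"
        using True by (auto simp: V_def)
      then have "emeasure lborel (Pair y -` V) = ennreal (((norm y + \<eta> / 4) ^ d - norm y ^ d) * c)"
        unfolding c_def d_def using emeasure_cone_shell[of "norm y" "norm y + \<eta> / 4" e a] \<eta> by simp
      moreover have "\<eta> / 4 * (1 / 4) ^ (d - 1) \<le> \<eta> / 4 * (norm y + \<eta> / 4) ^ (d - 1)"
        using \<eta> y by (intro mult_left_mono power_mono) auto
      moreover have "\<eta> / 4 * (norm y + \<eta> / 4) ^ (d - 1) \<le> (norm y + \<eta> / 4) ^ d - norm y ^ d"
        using power_diff_ge[of "norm y" "norm y + \<eta> / 4" d] \<eta> d by simp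
      ultimately have "emeasure lborel (Pair y -` V) = ennreal (((norm y + \<eta> / 4) ^ d - norm y ^ d) * c)"
        and "\<eta> / 4 * (1 / 4) ^ (d - 1) \<le> (norm y + \<eta> / 4) ^ d - norm y ^ d"
        by (blast intro: order.trans)+
      with True c0 show ?thesis
        by (simp only: indicator_simps mult_1_right) (intro ennreal_leI mult_right_mono)
    qed simp
    have S: "ennreal ((1 / 4) * (1 / 2) ^ (d - 1) * c) \<le> emeasure lborel S"
    proof -
      have "emeasure lborel S = ennreal (((1 / 2) ^ d - (1 / 4) ^ d) * c)"
        unfolding S_def c_def d_def by (rule emeasure_cone_shell) auto
      moreover have "(1 / 4) * (1 / 2) ^ (d - 1) \<le> (1 / 2 :: real) ^ d - (1 / 4) ^ d"
        using power_diff_ge[of "1 / 4" "1 / 2" d] d by simp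
      ultimately show ?thesis
        using c0 by (simp only:) (intro ennreal_leI mult_right_mono)
    qed
    have "\<kappa> * (a ^ (d - 1))\<^sup>2 * \<eta> * b =
      \<eta> / 4 * (1 / 4) ^ (d - 1) * ((1 / 4) * (1 / 2) ^ (d - 1)) * (v * a ^ (d - 1))\<^sup>2"
      using b0 by (simp add: \<kappa>_def power_mult_distrib mult_ac)
    also have "\<dots> \<le> \<eta> / 4 * (1 / 4) ^ (d - 1) * ((1 / 4) * (1 / 2) ^ (d - 1)) * c\<^sup>2"
      using c v0 a \<eta> by (intro mult_left_mono power_mono) auto
    also have "\<dots> = (\<eta> / 4 * (1 / 4) ^ (d - 1) * c) * ((1 / 4) * (1 / 2) ^ (d - 1) * c)"
      by (simp add: power2_eq_square mult_ac)
    finally have "ennreal (\<kappa> * (a ^ (d - 1))\<^sup>2 * \<eta> * b) \<le>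
       ennreal (\<eta> / 4 * (1 / 4) ^ (d - 1) * c) * ennreal ((1 / 4) * (1 / 2) ^ (d - 1) * c)"
      using \<eta> c0 by (subst ennreal_mult[symmetric]) (auto intro!: ennreal_leI)
    also have "\<dots> \<le> ennreal (\<eta> / 4 * (1 / 4) ^ (d - 1) * c) * emeasure lborel S"
      using S by (intro mult_left_mono) auto
    also have "\<dots> = (\<integral>\<^sup>+y. ennreal (\<eta> / 4 * (1 / 4) ^ (d - 1) * c) * indicator S y \<partial>lborel)"
      by (subst nn_integral_cmult_indicator) auto
    also have "\<dots> \<le> (\<integral>\<^sup>+y. emeasure lborel (Pair y -` V) \<partial>lborel)"
      using fib by (intro nn_integral_mono) auto
    also have "\<dots> = emeasure (lborel \<Otimes>\<^sub>M lborel) V"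
      by (rule lborel.emeasure_pair_measure_alt[symmetric]) (unfold lborel_prod, simp)
    also have "\<dots> = emeasure lborel V"
      unfolding lborel_prod ..
    also have "\<dots> \<le> emeasure lborel {w \<in> ball 0 1. w /\<^sub>R norm w \<in> cone_patch e a \<eta>}"
      using sub by (intro emeasure_mono) auto
    finally have "ennreal (\<kappa> * (a ^ (d - 1))\<^sup>2 * \<eta> * b) / ennreal b \<le> emeasure sphere_measure (cone_patch e a \<eta>)"
      by (simp add: emeasure_sphere_measure b divide_right_mono_ennreal)
    then have "ennreal (\<kappa> * (a ^ (d - 1))\<^sup>2 * \<eta>) \<le> emeasure sphere_measure (cone_patch e a \<eta>)"
      using b0 k0 \<eta> by (simp add: divide_ennreal)
    then show ?thesis
      by (simp only: finite_measure.emeasure_eq_measure[OF finite_measure_sphere_measure]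
        ennreal_le_iff[OF measure_nonneg] d_def)
  qed
  with k0 show thesis by (rule that)
qed

section \<open>Covering numbers and unions of cells\<close>

text \<open>The half-open cells of a grid are disjoint, unlike the intervals of a minimal cover, so
  volumes built over them add up. Their number dominates the covering number, which is the direction
  needed for lower bounds on test sets.\<close>

definition grid_cells :: "real set \<Rightarrow> real \<Rightarrow> int set" where
  "grid_cells F \<delta> = (\<lambda>t. \<lfloor>t / \<delta>\<rfloor>) ` F"

lemma floor_divide_bounds:
  assumes "\<delta> > (0::real)" "k = \<lfloor>t / \<delta>\<rfloor>"
  shows "of_int k * \<delta> \<le> t" "t < (of_int k + 1) * \<delta>"
proof -
  have "of_int k \<le> t / \<delta>" "t / \<delta> < of_int k + 1" using assms(2) by linarith+
  then show "of_int k * \<delta> \<le> t" "t < (of_int k + 1) * \<delta>"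
    using assms(1) by (simp_all add: field_simps)
qed

lemma finite_grid_cells:
  assumes "F \<subseteq> {1..2}" "\<delta> > 0"
  shows "finite (grid_cells F \<delta>)"
proof (rule finite_subset)
  show "grid_cells F \<delta> \<subseteq> {\<lfloor>1 / \<delta>\<rfloor>..\<lfloor>2 / \<delta>\<rfloor>}"
    unfolding grid_cells_def using assms
    by (auto intro!: floor_mono divide_right_mono dest!: subsetD)
qed simp

text \<open>Besides comparing the two counts, this shows that a finite cover exists, so that the
  \<open>LEAST\<close> in \<open>covering_number\<close> is attained.\<close>

lemma grid_cells_cover:
  assumes "F \<subseteq> {1..2}" "\<delta> > 0"
  shows "\<exists>A. finite A \<and> card A = card (grid_cells F \<delta>) \<and> F \<subseteq> (\<Union>a\<in>A. {a..a + \<delta>})"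
proof (intro exI conjI)
  let ?A = "(\<lambda>k. of_int k * \<delta>) ` grid_cells F \<delta>"
  show "finite ?A" using finite_grid_cells[OF assms] by simp
  show "card ?A = card (grid_cells F \<delta>)"
    using assms by (intro card_image inj_onI) auto
  show "F \<subseteq> (\<Union>a\<in>?A. {a..a + \<delta>})"
  proof
    fix t assume t: "t \<in> F"
    then show "t \<in> (\<Union>a\<in>?A. {a..a + \<delta>})"
      using floor_divide_bounds[OF assms(2) refl, of t] assms(2)
      by (auto simp: grid_cells_def algebra_simps intro!: bexI[OF _ t])
  qed
qed

lemma covering_number_le_card_grid_cells:
  assumes "F \<subseteq> {1..2}" "\<delta> > 0"
  shows "covering_number F \<delta> \<le> card (grid_cells F \<delta>)"
  unfolding covering_number_def using grid_cells_cover[OF assms] by (rule Least_le)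

lemma covering_number_pos:
  assumes "F \<subseteq> {1..2}" "\<delta> > 0" "F \<noteq> {}"
  shows "1 \<le> covering_number F \<delta>"
proof -
  have "\<exists>A. finite A \<and> card A = covering_number F \<delta> \<and> F \<subseteq> (\<Union>a\<in>A. {a..a + \<delta>})"
    unfolding covering_number_def using grid_cells_cover[OF assms(1,2)] by (rule LeastI)
  then obtain A where "finite A" "card A = covering_number F \<delta>" "F \<subseteq> (\<Union>a\<in>A. {a..a + \<delta>})"
    by blast
  with assms(3) show ?thesis
    by (cases "covering_number F \<delta>") auto
qed

section \<open>Test sets built from annuli and slabs\<close>

lemma card_mult_le_emeasure_UN:
  assumes "finite K" "disjoint_family_on X K" "\<And>k. k \<in> K \<Longrightarrow> X k \<in> sets M"
    "\<And>k. k \<in> K \<Longrightarrow> ennreal c \<le> emeasure M (X k)" "0 \<le> c"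
  shows "ennreal (real (card K) * c) \<le> emeasure M (\<Union>k\<in>K. X k)"
proof -
  have "ennreal (real (card K) * c) = (\<Sum>k\<in>K. ennreal c)"
    using assms(5) by (simp add: ennreal_mult ennreal_of_nat_eq_real_of_nat)
  also have "\<dots> \<le> (\<Sum>k\<in>K. emeasure M (X k))" using assms(4) by (rule sum_mono)
  also have "\<dots> = emeasure M (\<Union>k\<in>K. X k)"
    using assms by (intro sum_emeasure) auto
  finally show ?thesis .
qed

text \<open>The factor 1/sqrt 2 arises because x - t y = x - t z = 0 forces y = z, hence norm 1/sqrt
  2 for both on the unit sphere, and then x has norm t/sqrt 2.\<close>

definition annular_cells :: "real set \<Rightarrow> real \<Rightarrow> 'a::euclidean_space set" where
  "annular_cells F \<delta> = (\<Union>k\<in>grid_cells F \<delta>.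
     ball 0 ((of_int k + 1) * \<delta> / sqrt 2) - ball 0 (of_int k * \<delta> / sqrt 2))"

lemma annular_cells_emeasure_ge:
  assumes F: "F \<subseteq> {1..2}" and \<delta>: "\<delta> > 0"
  shows "annular_cells F \<delta> \<in> sets (borel :: 'a::euclidean_space measure)"
    "ennreal (real (card (grid_cells F \<delta>)) * (unit_ball_vol DIM('a) * (1 / sqrt 2) ^ DIM('a) * \<delta>))
      \<le> emeasure lborel (annular_cells F \<delta> :: 'a set)"
proof -
  let ?X = "\<lambda>k::int. ball (0::'a) ((of_int k + 1) * \<delta> / sqrt 2) - ball 0 (of_int k * \<delta> / sqrt 2)"
  let ?c = "unit_ball_vol DIM('a) * (1 / sqrt 2) ^ DIM('a) * \<delta>"
  have fin: "finite (grid_cells F \<delta>)" using F \<delta> by (rule finite_grid_cells)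
  show "annular_cells F \<delta> \<in> sets (borel :: 'a measure)"
    unfolding annular_cells_def using fin by auto
  show "ennreal (real (card (grid_cells F \<delta>)) * ?c) \<le> emeasure lborel (annular_cells F \<delta> :: 'a set)"
    unfolding annular_cells_def
  proof (rule card_mult_le_emeasure_UN[OF fin])
    have *: "(i + 1) * \<delta> / sqrt 2 \<le> j * \<delta> / sqrt 2" if "i + 1 \<le> j" for i j :: real
      using that \<delta> by (intro divide_right_mono mult_right_mono) auto
    show "disjoint_family_on ?X (grid_cells F \<delta>)"
      unfolding disjoint_family_on_def
    proof (intro ballI impI)
      fix i j :: int assume "i \<noteq> j"
      then consider "i + 1 \<le> j" | "j + 1 \<le> i" by linarith
      then show "?X i \<inter> ?X j = {}"
      proof cases
        case 1
        then show ?thesis using *[of "of_int i" "of_int j"] by auto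
      next
        case 2
        then show ?thesis using *[of "of_int j" "of_int i"] by auto
      qed
    qed
    fix k assume "k \<in> grid_cells F \<delta>"
    then obtain t where t: "t \<in> F" "k = \<lfloor>t / \<delta>\<rfloor>" by (auto simp: grid_cells_def)
    define r R where "r = of_int k * \<delta> / sqrt 2" and "R = (of_int k + 1) * \<delta> / sqrt 2"
    have t1: "1 \<le> t" using F t by auto
    then have "0 \<le> k" using t(2) \<delta> by simp
    then have r: "0 \<le> r" using \<delta> by (simp add: r_def)
    have Rr: "R - r = \<delta> / sqrt 2" by (simp add: R_def r_def algebra_simps diff_divide_distrib[symmetric])
    \<comment> \<open>The cell contains some t \<ge> 1, which bounds the outer radius from below;
      the inner radius may be smaller, and so the volume estimate uses \<open>R\<close>.\<close>
    have R1: "1 / sqrt 2 \<le> R"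
      unfolding R_def using floor_divide_bounds(2)[OF \<delta> t(2)] t1
      by (intro divide_right_mono) auto
    have rR: "r \<le> R" using Rr \<delta> by (smt (verit) divide_nonneg_nonneg real_sqrt_ge_0_iff)
    have "emeasure lborel (?X k) = emeasure lborel (ball (0::'a) R) - emeasure lborel (ball (0::'a) r)"
      unfolding r_def[symmetric] R_def[symmetric]
      using emeasure_lborel_ball_finite[of "0::'a" r] rR by (intro emeasure_Diff) auto
    also have "\<dots> = ennreal (unit_ball_vol DIM('a) * (R ^ DIM('a) - r ^ DIM('a)))"
      using r rR by (simp add: emeasure_ball ennreal_minus right_diff_distrib)
    finally have eq: "emeasure lborel (?X k) = \<dots>" .
    have "\<delta> / sqrt 2 * (1 / sqrt 2) ^ (DIM('a) - 1) \<le> (R - r) * R ^ (DIM('a) - 1)"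
      unfolding Rr using R1 \<delta> by (intro mult_left_mono power_mono) auto
    also have "\<dots> \<le> R ^ DIM('a) - r ^ DIM('a)" using r rR by (intro power_diff_ge) auto
    finally have "(1 / sqrt 2) ^ DIM('a) * \<delta> \<le> R ^ DIM('a) - r ^ DIM('a)"
      by (simp add: power_DIM[where 'a='a] mult_ac)
    then have "unit_ball_vol DIM('a) * ((1 / sqrt 2) ^ DIM('a) * \<delta>) \<le> unit_ball_vol DIM('a) * (R ^ DIM('a) - r ^ DIM('a))"
      by (rule mult_left_mono) simp
    then show "ennreal ?c \<le> emeasure lborel (?X k)"
      unfolding eq by (intro ennreal_leI) (simp only: mult.assoc)
  qed (use \<delta> in auto)
qed

lemma annular_cellsE:
  assumes "x \<in> annular_cells F \<delta>" "\<delta> > 0"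
  obtains t where "t \<in> F" "\<bar>norm x - t / sqrt 2\<bar> \<le> \<delta> / sqrt 2"
proof -
  from assms(1) obtain t where t: "t \<in> F"
    and x: "of_int \<lfloor>t / \<delta>\<rfloor> * \<delta> / sqrt 2 \<le> norm x" "norm x < (of_int \<lfloor>t / \<delta>\<rfloor> + 1) * \<delta> / sqrt 2"
    by (auto simp: annular_cells_def grid_cells_def not_less)
  have b: "of_int \<lfloor>t / \<delta>\<rfloor> * \<delta> / sqrt 2 \<le> t / sqrt 2" "t / sqrt 2 \<le> (of_int \<lfloor>t / \<delta>\<rfloor> + 1) * \<delta> / sqrt 2"
    using floor_divide_bounds[OF assms(2) refl, of t] by (auto intro!: divide_right_mono)
  have "(of_int \<lfloor>t / \<delta>\<rfloor> + 1) * \<delta> / sqrt 2 = of_int \<lfloor>t / \<delta>\<rfloor> * \<delta> / sqrt 2 + \<delta> / sqrt 2"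
    by (simp add: algebra_simps add_divide_distrib)
  with x b have "\<bar>norm x - t / sqrt 2\<bar> \<le> \<delta> / sqrt 2" by linarith
  with t show thesis by (rule that)
qed

text \<open>Used with \<open>e\<close> in the basis, so that every cell is an axis-parallel box
  whose volume is a product of side lengths. The division by sqrt 2 turns a shift of the radius
  parameter \<open>t\<close> into the matching shift along the axis.\<close>

definition slab_cells :: "'a::euclidean_space \<Rightarrow> real \<Rightarrow> real \<Rightarrow> real set \<Rightarrow> real \<Rightarrow> 'a set" where
  "slab_cells e \<rho> t0 F \<delta> = (\<Union>k\<in>grid_cells F \<delta>.
     box (\<Sum>b\<in>Basis. (if b = e then (of_int k * \<delta> - t0) / sqrt 2 else - \<rho>) *\<^sub>R b)
         (\<Sum>b\<in>Basis. (if b = e then ((of_int k + 1) * \<delta> - t0) / sqrt 2 else \<rho>) *\<^sub>R b))"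

lemma slab_cells_emeasure_ge:
  fixes e :: "'a::euclidean_space"
  assumes F: "F \<subseteq> {1..2}" and \<delta>: "\<delta> > 0" and e: "e \<in> Basis" and \<rho>: "\<rho> > 0"
  shows "slab_cells e \<rho> t0 F \<delta> \<in> sets borel"
    "ennreal (real (card (grid_cells F \<delta>)) * ((2 * \<rho>) ^ (DIM('a) - 1) * (\<delta> / sqrt 2)))
      \<le> emeasure lborel (slab_cells e \<rho> t0 F \<delta>)"
proof -
  let ?l = "\<lambda>k::int. \<Sum>b\<in>Basis. (if b = e then (of_int k * \<delta> - t0) / sqrt 2 else - \<rho>) *\<^sub>R b"
  let ?u = "\<lambda>k::int. \<Sum>b\<in>Basis. (if b = e then ((of_int k + 1) * \<delta> - t0) / sqrt 2 else \<rho>) *\<^sub>R b"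
  let ?c = "(2 * \<rho>) ^ (DIM('a) - 1) * (\<delta> / sqrt 2)"
  have fin: "finite (grid_cells F \<delta>)" using F \<delta> by (rule finite_grid_cells)
  show "slab_cells e \<rho> t0 F \<delta> \<in> sets borel"
    unfolding slab_cells_def using fin by auto
  have cmp: "(of_int k * \<delta> - t0) / sqrt 2 \<le> ((of_int k + 1) * \<delta> - t0) / sqrt 2" for k :: int
    using \<delta> by (intro divide_right_mono) (auto simp: algebra_simps)
  show "ennreal (real (card (grid_cells F \<delta>)) * ?c) \<le> emeasure lborel (slab_cells e \<rho> t0 F \<delta>)"
    unfolding slab_cells_def
  proof (rule card_mult_le_emeasure_UN[OF fin])
    have *: "((i + 1) * \<delta> - t0) / sqrt 2 \<le> (j * \<delta> - t0) / sqrt 2" if "i + 1 \<le> j" for i j :: real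
      using that \<delta> by (intro divide_right_mono diff_right_mono mult_right_mono) auto
    have disj: "box (?l i) (?u i) \<inter> box (?l j) (?u j) = {}" if "i + 1 \<le> j" for i j :: int
    proof -
      have "((of_int i + 1) * \<delta> - t0) / sqrt 2 \<le> (of_int j * \<delta> - t0) / sqrt 2"
        using that by (intro *) linarith
      then show ?thesis using e by (fastforce simp: mem_box)
    qed
    show "disjoint_family_on (\<lambda>k. box (?l k) (?u k)) (grid_cells F \<delta>)"
      unfolding disjoint_family_on_def
    proof (intro ballI impI)
      fix i j :: int assume "i \<noteq> j"
      then consider "i + 1 \<le> j" | "j + 1 \<le> i" by linarith
      then show "box (?l i) (?u i) \<inter> box (?l j) (?u j) = {}"
        using disj[of i j] disj[of j i] by cases (auto simp: Int_commute)
    qed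
    fix k
    have "emeasure lborel (box (?l k) (?u k)) = ennreal (\<Prod>b\<in>Basis. (?u k - ?l k) \<bullet> b)"
      using cmp[of k] \<rho> by (intro emeasure_lborel_box) auto
    also have "(\<Prod>b\<in>Basis. (?u k - ?l k) \<bullet> b) = (\<Prod>b\<in>Basis. if b = e then \<delta> / sqrt 2 else 2 * \<rho>)"
      by (rule prod.cong) (auto simp: inner_diff_left field_simps)
    also have "\<dots> = ?c"
      using e by (subst prod.remove[OF _ e]) (simp_all add: card_Diff_singleton mult.commute
          prod.cong[of "Basis - {e}" _ "\<lambda>b. if b = e then \<delta> / sqrt 2 else 2 * \<rho>" "\<lambda>_. 2 * \<rho>"])
    finally show "ennreal ?c \<le> emeasure lborel (box (?l k) (?u k))" by simp
  qed (use \<delta> \<rho> in auto)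
qed

text \<open>The dimension in the last bound comes from estimating the Euclidean norm by the sum of
  the coordinates; it is absorbed later by taking \<open>\<rho> = a * L / d\<close>.\<close>

lemma slab_cellsE:
  fixes e :: "'a::euclidean_space" and \<rho> :: real
  assumes "x \<in> slab_cells e \<rho> t0 F \<delta>" "\<delta> > 0" "e \<in> Basis" "0 \<le> \<rho>"
  obtains t where "t \<in> F" "\<bar>x \<bullet> e - (t - t0) / sqrt 2\<bar> \<le> \<delta>"
    "norm (x - (x \<bullet> e) *\<^sub>R e) \<le> DIM('a) * \<rho>"
proof -
  from assms(1) obtain t where t: "t \<in> F"
    and x: "x \<in> box (\<Sum>b\<in>Basis. (if b = e then (of_int \<lfloor>t / \<delta>\<rfloor> * \<delta> - t0) / sqrt 2 else - \<rho>) *\<^sub>R b)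
         (\<Sum>b\<in>Basis. (if b = e then ((of_int \<lfloor>t / \<delta>\<rfloor> + 1) * \<delta> - t0) / sqrt 2 else \<rho>) *\<^sub>R b)"
    by (auto simp: slab_cells_def grid_cells_def)
  have xe: "(of_int \<lfloor>t / \<delta>\<rfloor> * \<delta> - t0) / sqrt 2 < x \<bullet> e"
    "x \<bullet> e < ((of_int \<lfloor>t / \<delta>\<rfloor> + 1) * \<delta> - t0) / sqrt 2"
    using x assms(3) by (auto simp: mem_box)
  have xb: "\<bar>x \<bullet> b\<bar> \<le> \<rho>" if "b \<in> Basis" "b \<noteq> e" for b
    using x that by (fastforce simp: mem_box)
  have b: "(of_int \<lfloor>t / \<delta>\<rfloor> * \<delta> - t0) / sqrt 2 \<le> (t - t0) / sqrt 2"
    "(t - t0) / sqrt 2 \<le> ((of_int \<lfloor>t / \<delta>\<rfloor> + 1) * \<delta> - t0) / sqrt 2"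
    using floor_divide_bounds[OF assms(2) refl, of t] by (auto intro!: divide_right_mono)
  have "((of_int \<lfloor>t / \<delta>\<rfloor> + 1) * \<delta> - t0) / sqrt 2 = (of_int \<lfloor>t / \<delta>\<rfloor> * \<delta> - t0) / sqrt 2 + \<delta> / sqrt 2"
    by (simp add: algebra_simps add_divide_distrib diff_divide_distrib)
  moreover have "\<delta> / sqrt 2 \<le> \<delta>" using assms(2) by (simp add: divide_le_eq)
  ultimately have 1: "\<bar>x \<bullet> e - (t - t0) / sqrt 2\<bar> \<le> \<delta>" using xe b by linarith
  have "norm (x - (x \<bullet> e) *\<^sub>R e) \<le> (\<Sum>b\<in>Basis. \<bar>(x - (x \<bullet> e) *\<^sub>R e) \<bullet> b\<bar>)"
    by (rule norm_le_l1)
  also have "\<dots> \<le> (\<Sum>b\<in>(Basis::'a set). \<rho>)"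
  proof (rule sum_mono)
    fix b :: 'a assume b: "b \<in> Basis"
    show "\<bar>(x - (x \<bullet> e) *\<^sub>R e) \<bullet> b\<bar> \<le> \<rho>"
    proof (cases "b = e")
      case True
      then show ?thesis using assms(3,4) by (simp add: inner_diff_left)
    next
      case False
      then show ?thesis using xb[OF b] assms(3) b
        by (simp add: inner_diff_left inner_Basis)
    qed
  qed
  also have "\<dots> = DIM('a) * \<rho>" by simp
  finally have "norm (x - (x \<bullet> e) *\<^sub>R e) \<le> DIM('a) * \<rho>" .
  with t 1 show thesis by (rule that)
qed

section \<open>Geometry of the examples\<close>

lemma inverse_sqrt2_bounds: "7 / 10 \<le> 1 / sqrt 2" "1 / sqrt 2 \<le> 71 / 100"
proof -
  have s: "(1 / sqrt 2)\<^sup>2 = 1 / 2" by (simp add: power_divide)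
  show "7 / 10 \<le> 1 / sqrt 2"
    by (rule power2_le_imp_le) (simp_all only: s, simp_all add: power_divide)
  show "1 / sqrt 2 \<le> 71 / 100"
    by (rule power2_le_imp_le) (simp_all only: s, simp_all add: power_divide)
qed

lemma axial_coneD:
  fixes e :: "'a::euclidean_space"
  assumes "y \<in> axial_cone e a" "norm e = 1" "0 < a"
  defines "y' \<equiv> y - (y \<bullet> e) *\<^sub>R e"
  shows "norm y' \<le> a * (y \<bullet> e)" "0 \<le> y \<bullet> e" "y \<bullet> e \<le> norm y" "(norm y)\<^sup>2 = (y \<bullet> e)\<^sup>2 + (norm y')\<^sup>2"
    "y' \<bullet> e = 0" "norm y \<le> y \<bullet> e + norm y'"
proof -
  have ee: "e \<bullet> e = 1" using assms(2) by (simp add: norm_eq_1)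
  show 1: "norm y' \<le> a * (y \<bullet> e)" using assms(1) by (simp add: axial_cone_def y'_def)
  show 2: "0 \<le> y \<bullet> e" using order.trans[OF norm_ge_zero 1] assms(3) by (simp add: zero_le_mult_iff)
  show "y \<bullet> e \<le> norm y" using norm_cauchy_schwarz[of y e] assms(2) by simp
  show "y' \<bullet> e = 0" by (simp add: y'_def inner_diff_left ee)
  show "(norm y)\<^sup>2 = (y \<bullet> e)\<^sup>2 + (norm y')\<^sup>2"
    unfolding power2_norm_eq_inner y'_def
    by (simp add: inner_diff_left inner_diff_right ee power2_eq_square inner_commute)
  show "norm y \<le> y \<bullet> e + norm y'"
    using norm_triangle_ineq[of "(y \<bullet> e) *\<^sub>R e" y'] 2 assms(2) by (simp add: y'_def)
qed

text \<open>Both x/t and \<open>y\<close> are close to e/sqrt 2. The radial error of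
  \<open>x\<close> is at most \<delta>, and \<open>y\<close> has axial error at most 2\<delta> and
  orthogonal error at most \<delta>; as t \<le> 2, the total is at most 7\<delta>.\<close>

lemma ball_patch_geometry:
  fixes x y :: "'a::euclidean_space"
  assumes e: "norm e = 1" and x: "x = norm x *\<^sub>R e" "\<bar>norm x - t / sqrt 2\<bar> \<le> \<delta> / sqrt 2"
    and y: "y \<in> axial_cone e \<delta>" "\<bar>norm y - 1 / sqrt 2\<bar> \<le> \<delta>"
    and t: "0 \<le> t" "t \<le> 2" and \<delta>: "0 < \<delta>" "\<delta> \<le> 1 / 4"
  shows "x - t *\<^sub>R y \<in> ball 0 (8 * \<delta>)"
proof -
  define y' where "y' = y - (y \<bullet> e) *\<^sub>R e"
  note yc = axial_coneD[OF y(1) e \<delta>(1), folded y'_def]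
  have "y \<bullet> e \<le> 1" using yc(3) y(2) \<delta> inverse_sqrt2_bounds by linarith
  then have y'1: "norm y' \<le> \<delta>" using yc(1) mult_left_mono[of "y \<bullet> e" 1 \<delta>] \<delta> by linarith
  have ye: "\<bar>y \<bullet> e - 1 / sqrt 2\<bar> \<le> 2 * \<delta>" using yc(3,6) y'1 y(2) by linarith
  have "x - t *\<^sub>R y = (norm x - t / sqrt 2) *\<^sub>R e - t *\<^sub>R ((y \<bullet> e - 1 / sqrt 2) *\<^sub>R e + y')"
    by (subst x(1)) (simp add: y'_def algebra_simps)
  also have "norm \<dots> \<le> norm ((norm x - t / sqrt 2) *\<^sub>R e) + norm (t *\<^sub>R ((y \<bullet> e - 1 / sqrt 2) *\<^sub>R e + y'))"
    by (rule norm_triangle_ineq4)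
  also have "norm (t *\<^sub>R ((y \<bullet> e - 1 / sqrt 2) *\<^sub>R e + y')) \<le> 2 * (\<bar>y \<bullet> e - 1 / sqrt 2\<bar> + norm y')"
    using norm_triangle_ineq[of "(y \<bullet> e - 1 / sqrt 2) *\<^sub>R e" y'] e t
    unfolding norm_scaleR by (intro mult_mono) auto
  also have "norm ((norm x - t / sqrt 2) *\<^sub>R e) \<le> \<delta> / sqrt 2" using x(2) e by simp
  also have "\<delta> / sqrt 2 \<le> \<delta>" using \<delta> by (simp add: divide_le_eq)
  finally have "norm (x - t *\<^sub>R y) \<le> \<delta> + 2 * (\<bar>y \<bullet> e - 1 / sqrt 2\<bar> + norm y')" by simp
  then show ?thesis using ye y'1 \<delta> by simp
qed

text \<open>
  With \<open>\<delta> = a\<^sup>2 L\<close>, all the error terms in \<open>\<bar>t y - x\<bar>\<^sup>2 - (t \<bar>y\<bar> - x\<^sub>e)\<^sup>2\<close> are \<open>O(\<delta>)\<close>: the spheres of radius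
  \<open>t/\<surd>2\<close>, \<open>t0 \<le> t \<le> t0 + L\<close>, restricted to a cap of width \<open>a\<close> and translated to touch each other, agree up to
  \<open>O(a\<^sup>2 L)\<close>.
\<close>

lemma cap_patch_geometry:
  fixes x y e :: "'a::euclidean_space" and a L t t0 :: real
  defines "\<delta> \<equiv> a\<^sup>2 * L"
  assumes e: "norm e = 1" and a: "0 < a" "a \<le> 1" and L: "0 < L" "L \<le> 1 / 10" and \<delta>100: "\<delta> \<le> 1 / 100"
    and t: "1 \<le> t0" "t0 \<le> t" "t \<le> t0 + L" "t \<le> 2"
    and x: "\<bar>x \<bullet> e - (t - t0) / sqrt 2\<bar> \<le> \<delta>" "norm (x - (x \<bullet> e) *\<^sub>R e) \<le> a * L"
    and y: "y \<in> axial_cone e a" "\<bar>norm y - 1 / sqrt 2\<bar> \<le> \<delta>"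
  shows "x - t *\<^sub>R y \<in> {u \<in> axial_cone (- e) (40 * a).
    t0 / sqrt 2 - 40 * \<delta> < norm u \<and> norm u \<le> t0 / sqrt 2 + 40 * \<delta>}"
proof -
  have ee: "e \<bullet> e = 1" using e by (simp add: norm_eq_1)
  define y' x' s where "y' = y - (y \<bullet> e) *\<^sub>R e" and "x' = x - (x \<bullet> e) *\<^sub>R e" and "s = x \<bullet> e"
  note yc = axial_coneD[OF y(1) e a(1), folded y'_def]
  define r where "r = y \<bullet> e"
  have yr: "y = r *\<^sub>R e + y'" and xs: "x = s *\<^sub>R e + x'" by (simp_all add: r_def s_def x'_def y'_def)
  have ey': "e \<bullet> y' = 0" "y' \<bullet> e = 0" "e \<bullet> x' = 0" "x' \<bullet> e = 0"
    by (simp_all add: x'_def y'_def inner_diff_left inner_diff_right ee inner_commute)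
  have \<delta>0: "0 < \<delta>" using a L by (simp add: \<delta>_def)
  have a2: "a\<^sup>2 \<le> 1" using a by (simp add: power_le_one)
  have \<delta>L: "\<delta> \<le> L" using a2 L by (simp add: \<delta>_def)
  have k: "7 / 10 \<le> 1 / sqrt 2" "1 / sqrt 2 \<le> 71 / 100" by (fact inverse_sqrt2_bounds)+
  have tk: "(t - t0) / sqrt 2 \<le> L" "0 \<le> (t - t0) / sqrt 2"
    using t L mult_mono[of "t - t0" L "1 / sqrt 2" 1] k by auto
  have tk': "(t - t0) / sqrt 2 \<le> L * (71 / 100)"
    using t L mult_mono[of "t - t0" L "1 / sqrt 2" "71 / 100"] k by auto
  have s: "\<bar>s\<bar> \<le> 2 * L" "s \<le> 81 / 1000"
    using x(1) tk tk' \<delta>L L \<delta>100 unfolding s_def by linarith+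
  have Y: "69 / 100 \<le> norm y" "norm y \<le> 1" using y(2) k \<delta>100 \<delta>0 by linarith+
  have r: "0 \<le> r" "r \<le> norm y" "norm y' \<le> a * r" "(norm y)\<^sup>2 = r\<^sup>2 + (norm y')\<^sup>2"
    using yc by (simp_all add: r_def)
  have y'2: "(norm y')\<^sup>2 \<le> a\<^sup>2 * r\<^sup>2"
    using power_mono[OF r(3), of 2] by (simp add: power_mult_distrib)
  \<comment> \<open>As a \<le> 1, the squared norm of \<open>y\<close> is at most twice the square
    of \<open>r\<close>, and \<open>y\<close> has norm at least 69/100. This keeps the axial
    component of \<open>t *\<^sub>R y - x\<close> away from 0.\<close>
  have r45: "45 / 100 \<le> r"
  proof (rule ccontr)
    assume "\<not> ?thesis"
    then have "r\<^sup>2 \<le> (45 / 100)\<^sup>2" using r by (intro power_mono) auto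
    moreover have "(69 / 100)\<^sup>2 \<le> (norm y)\<^sup>2" using Y by (intro power_mono) auto
    moreover have "(norm y')\<^sup>2 \<le> r\<^sup>2" using y'2 mult_right_mono[OF a2, of "r\<^sup>2"] by simp
    ultimately show False using r(4) by (simp add: power2_eq_square)
  qed
  \<comment> \<open>The height of a cap is quadratic in its width.\<close>
  have Yr: "norm y - r \<le> a\<^sup>2"
  proof -
    have "(norm y - r) * r \<le> (norm y - r) * (norm y + r)"
      using r by (intro mult_left_mono) auto
    also have "\<dots> = (norm y')\<^sup>2" using r(4) by (simp add: power2_eq_square algebra_simps)
    also have "\<dots> \<le> a\<^sup>2 * r * r" using y'2 by (simp add: power2_eq_square algebra_simps)
    finally have "norm y - r \<le> a\<^sup>2 * r" using r45 by (simp add: mult_le_cancel_right)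
    also have "\<dots> \<le> a\<^sup>2" using r Y mult_left_mono[of r 1 "a\<^sup>2"] by simp
    finally show ?thesis .
  qed
  have y'a: "norm y' \<le> a" using r(2,3) Y a mult_left_mono[of r 1 a] by linarith
  define u where "u = t *\<^sub>R y - x"
  have ur: "u = (t * r - s) *\<^sub>R e + (t *\<^sub>R y' - x')" by (simp add: u_def yr xs algebra_simps)
  have ue: "u \<bullet> e = t * r - s" by (simp add: ur inner_add_left inner_diff_left ee ey')
  have tr: "r \<le> t * r" using t r mult_right_mono[of 1 t r] by simp
  have ue5: "1 / 5 \<le> u \<bullet> e" using tr r45 s ue by linarith
  have "norm (u - (u \<bullet> e) *\<^sub>R e) = norm (t *\<^sub>R y' - x')" by (simp add: ue) (simp add: ur)
  also have "\<dots> \<le> t * norm y' + norm x'"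
    using norm_triangle_ineq4[of "t *\<^sub>R y'" x'] t by simp
  also have "\<dots> \<le> 2 * (a * 1) + a * 1"
  proof (intro add_mono mult_mono)
    show "norm y' \<le> a * 1" using y'a by simp
    show "norm x' \<le> a * 1" using x(2) L a mult_left_mono[of L 1 a] unfolding x'_def by linarith
  qed (use t in auto)
  also have "\<dots> = 15 * a * (1 / 5)" by simp
  also have "\<dots> \<le> 40 * a * (u \<bullet> e)" using ue5 a by (intro mult_mono) auto
  finally have "norm (u - (u \<bullet> e) *\<^sub>R e) \<le> 40 * a * (u \<bullet> e)" .
  moreover have "x - t *\<^sub>R y = - u" by (simp add: u_def)
  ultimately have cone: "x - t *\<^sub>R y \<in> axial_cone (- e) (40 * a)"
    by (simp add: axial_cone_def norm_minus_commute)
  \<comment> \<open>The value that the norm of \<open>u\<close> would have if \<open>x\<close> and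
    \<open>y\<close> were parallel to \<open>e\<close>.\<close>
  define P where "P = t * norm y - s"
  have nu: "(norm u)\<^sup>2 = (t * r - s)\<^sup>2 + (norm (t *\<^sub>R y' - x'))\<^sup>2"
    unfolding power2_norm_eq_inner ur
    by (simp add: inner_add_left inner_add_right inner_diff_left inner_diff_right ee ey' power2_eq_square)
  have nv: "(norm (t *\<^sub>R y' - x'))\<^sup>2 = t\<^sup>2 * (norm y')\<^sup>2 - 2 * t * (y' \<bullet> x') + (norm x')\<^sup>2"
    unfolding power2_norm_eq_inner
    by (simp add: inner_diff_left inner_diff_right power2_eq_square algebra_simps inner_commute)
  \<comment> \<open>By Pythagoras for \<open>y\<close> the terms quadratic in \<open>t\<close>
    cancel. The three remaining errors are bounded by 8\<delta>, 4\<delta> and \<delta>.\<close>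
  have "(norm u)\<^sup>2 - P\<^sup>2 = t\<^sup>2 * (r\<^sup>2 + (norm y')\<^sup>2 - (norm y)\<^sup>2) + 2 * t * (s * (norm y - r)) - 2 * t * (y' \<bullet> x') + (norm x')\<^sup>2"
    unfolding nu nv P_def by (simp add: power2_eq_square algebra_simps)
  then have eq: "(norm u)\<^sup>2 - P\<^sup>2 = 2 * t * (s * (norm y - r)) - 2 * t * (y' \<bullet> x') + (norm x')\<^sup>2"
    using r(4) by simp
  have "\<bar>s * (norm y - r)\<bar> \<le> 2 * L * a\<^sup>2"
    unfolding abs_mult using s(1) Yr r by (intro mult_mono) auto
  then have "2 * t * \<bar>s * (norm y - r)\<bar> \<le> 4 * (2 * L * a\<^sup>2)"
    using t by (intro mult_mono) auto
  moreover have "\<bar>2 * t * (s * (norm y - r))\<bar> = 2 * t * \<bar>s * (norm y - r)\<bar>"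
    using t by (simp add: abs_mult)
  moreover have "4 * (2 * L * a\<^sup>2) = 8 * \<delta>" by (simp add: \<delta>_def)
  ultimately have e1: "\<bar>2 * t * (s * (norm y - r))\<bar> \<le> 8 * \<delta>" by linarith
  have "\<bar>y' \<bullet> x'\<bar> \<le> norm y' * norm x'" by (rule Cauchy_Schwarz_ineq2)
  also have "\<dots> \<le> a * (a * L)"
    using y'a a x(2) by (intro mult_mono) (auto simp: x'_def)
  also have "\<dots> = \<delta>" by (simp add: \<delta>_def power2_eq_square)
  finally have "2 * t * \<bar>y' \<bullet> x'\<bar> \<le> 4 * \<delta>"
    using t by (intro mult_mono) auto
  then have e2: "\<bar>2 * t * (y' \<bullet> x')\<bar> \<le> 4 * \<delta>" using t by (simp add: abs_mult)
  have "(norm x')\<^sup>2 \<le> (a * L)\<^sup>2" using x(2) by (intro power_mono) (auto simp: x'_def)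
  also have "\<dots> = \<delta> * L" by (simp add: \<delta>_def power2_eq_square)
  also have "\<dots> \<le> \<delta>" using \<delta>0 L by simp
  finally have e3: "\<bar>(norm x')\<^sup>2\<bar> \<le> \<delta>" by simp
  have uP: "\<bar>(norm u)\<^sup>2 - P\<^sup>2\<bar> \<le> 13 * \<delta>" using eq e1 e2 e3 by linarith
  have "P - t0 / sqrt 2 = t * (norm y - 1 / sqrt 2) + ((t - t0) / sqrt 2 - s)"
    by (simp add: P_def algebra_simps diff_divide_distrib)
  moreover have "\<bar>t * (norm y - 1 / sqrt 2)\<bar> \<le> 2 * \<delta>"
    unfolding abs_mult using t y(2) by (intro mult_mono) auto
  ultimately have Pt: "\<bar>P - t0 / sqrt 2\<bar> \<le> 3 * \<delta>" using x(1) unfolding s_def by linarith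
  have "1 / sqrt 2 \<le> t0 / sqrt 2" using t by (intro divide_right_mono) auto
  then have P1: "1 / 2 \<le> P" using Pt k \<delta>100 by linarith
  \<comment> \<open>Dividing the difference of squares by a sum of at least 1/2 turns 13\<delta>
    into 26\<delta>; the distance 3\<delta> from \<open>P\<close> to t0/sqrt 2 is added
    afterwards.\<close>
  have "\<bar>norm u - P\<bar> * (1 / 2) \<le> \<bar>norm u - P\<bar> * (norm u + P)"
    using P1 norm_ge_zero[of u] by (intro mult_left_mono) linarith+
  also have "\<dots> = \<bar>(norm u)\<^sup>2 - P\<^sup>2\<bar>"
    using P1 by (simp add: power2_eq_square square_diff_square_factored abs_mult mult.commute)
  also note uP
  finally have "\<bar>norm u - P\<bar> \<le> 26 * \<delta>" by simp
  then have "\<bar>norm u - t0 / sqrt 2\<bar> \<le> 29 * \<delta>" using Pt by linarith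
  moreover have "norm (x - t *\<^sub>R y) = norm u" by (simp add: u_def norm_minus_commute)
  ultimately show ?thesis using cone \<delta>0 by auto
qed

section \<open>Consequences of boundedness\<close>

text \<open>The patch imposes the same condition on both components, so an inclusion for single
  vectors settles the one for pairs.\<close>

lemma measure_patch_mono:
  fixes F :: "'a::euclidean_space set"
  assumes [measurable]: "F \<in> sets borel"
    and "\<And>y. y \<in> axial_cone e a \<Longrightarrow> \<bar>norm y - 1 / sqrt 2\<bar> \<le> \<eta> \<Longrightarrow> x - t *\<^sub>R y \<in> F"
  shows "measure sphere_measure (cone_patch e a \<eta>)
    \<le> measure sphere_measure {w. x - t *\<^sub>R fst w \<in> F \<and> x - t *\<^sub>R snd w \<in> F}"
proof (rule finite_measure.finite_measure_mono[OF finite_measure_sphere_measure])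
  show "cone_patch e a \<eta> \<subseteq> {w. x - t *\<^sub>R fst w \<in> F \<and> x - t *\<^sub>R snd w \<in> F}"
    using assms(2) by (auto simp: cone_patch_def)
  have "{w::'a \<times> 'a. x - t *\<^sub>R fst w \<in> F \<and> x - t *\<^sub>R snd w \<in> F} \<in> sets borel" by measurable
  then show "{w. x - t *\<^sub>R fst w \<in> F \<and> x - t *\<^sub>R snd w \<in> F} \<in> sets sphere_measure" by simp
qed

lemma measure_sphere_measure_sphere:
  "measure sphere_measure (sphere (0::'b::euclidean_space) 1) = 1"
proof -
  have "{v \<in> ball (0::'b) 1. v /\<^sub>R norm v \<in> sphere 0 1} = ball 0 1 - {0}"
    by auto
  moreover have "emeasure lborel (ball (0::'b) 1 - {0}) = emeasure lborel (ball (0::'b) 1)"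
    by (subst emeasure_Diff) auto
  ultimately have "emeasure sphere_measure (sphere (0::'b) 1) = 1"
    using emeasure_ball_finite_pos[where 'b='b]
    by (simp add: emeasure_sphere_measure ennreal_divide_self less_top)
  then show ?thesis by (simp add: measure_def)
qed

text \<open>Upper limits provide good scales only frequently, and that suffices: if
  \<open>v > u\<close>, the quotient of the two sides tends to 0, so the inequality would fail at
  all small scales.\<close>

lemma powr_compare_at_0:
  assumes fr: "\<exists>\<^sub>F \<delta> in at_right 0. A * \<delta> powr u \<le> B * \<delta> powr v" and "A > 0"
  shows "v \<le> (u::real)"
proof (rule ccontr)
  assume "\<not> ?thesis"
  then have uv: "0 < v - u" by simp
  have "((\<lambda>\<delta>::real. \<delta> powr (v - u)) \<longlongrightarrow> 0) (at_right 0)"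
    using uv by real_asymp
  then have "((\<lambda>\<delta>::real. B * \<delta> powr (v - u)) \<longlongrightarrow> 0) (at_right 0)"
    by (rule tendsto_mult_right_zero)
  then have "eventually (\<lambda>\<delta>. B * \<delta> powr (v - u) < A) (at_right 0)"
    using \<open>A > 0\<close> by (rule order_tendstoD(2))
  then have "eventually (\<lambda>\<delta>. \<not> A * \<delta> powr u \<le> B * \<delta> powr v) (at_right 0)"
    using eventually_at_right_less[of 0]
  proof eventually_elim
    case (elim \<delta>)
    then have "B * \<delta> powr (v - u) * \<delta> powr u < A * \<delta> powr u"
      by (intro mult_strict_right_mono) auto
    moreover have "\<delta> powr (v - u) * \<delta> powr u = \<delta> powr v" by (simp flip: powr_add)
    ultimately show ?case by (simp add: mult.assoc)
  qed
  with fr show False by (simp add: frequently_def)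
qed

lemma le_add_mult_epsilon:
  fixes A B K :: real
  assumes "\<epsilon>0 > 0" "\<And>\<epsilon>. 0 < \<epsilon> \<Longrightarrow> \<epsilon> < \<epsilon>0 \<Longrightarrow> A \<le> B + K * \<epsilon>"
  shows "A \<le> B"
proof (rule tendsto_lowerbound)
  show "((\<lambda>\<epsilon>. B + K * \<epsilon>) \<longlongrightarrow> B) (at_right 0)"
    by (auto intro!: tendsto_eq_intros)
  show "eventually (\<lambda>\<epsilon>. A \<le> B + K * \<epsilon>) (at_right 0)"
    using eventually_at_right_real[OF assms(1)] by eventually_elim (use assms(2) in auto)
qed simp

section \<open>The test examples: large balls, small balls, caps\<close>

lemma recip_le_recip_add:
  assumes bdd: "spherical_maximal_bounded TYPE('a::euclidean_space) E p q r" "0 < p" "0 < q" "0 < r"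
    and E: "E \<subseteq> {1..2}" "E \<noteq> {}"
  shows "recip r \<le> recip p + recip q"
proof -
  define m s d where "m = recip r" and "s = recip p + recip q" and "d = DIM('a)"
  obtain C where C: "C > 0" and bound:
    "\<And>(F::'a set) H f h c. F \<in> sets borel \<Longrightarrow> H \<in> sets borel \<Longrightarrow>
      emeasure lborel F \<le> ennreal f \<Longrightarrow> ennreal h \<le> emeasure lborel H \<Longrightarrow> f > 0 \<Longrightarrow> h > 0 \<Longrightarrow> c \<ge> 0 \<Longrightarrow>
      (\<And>x. x \<in> H \<Longrightarrow> \<exists>t\<in>E. c \<le> measure sphere_measure {w. x - t *\<^sub>R fst w \<in> F \<and> x - t *\<^sub>R snd w \<in> F}) \<Longrightarrow>
      c * h powr m \<le> C * f powr s"
    unfolding m_def s_def using spherical_maximal_bounded_indicatorE[OF bdd] by blast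
  obtain t where t: "t \<in> E" "0 \<le> t" "t \<le> 2" using E by force
  define v where "v = unit_ball_vol (real d)"
  have v: "v > 0" by (simp add: v_def)
  have "(v / 2 ^ d) powr m * \<delta> powr (- (real d * m)) \<le> (C * v powr s) * \<delta> powr (- (real d * s))"
    if \<delta>: "\<delta> \<in> {0<..<1/4}" for \<delta> :: real
  proof -
    \<comment> \<open>Large radii are written through small \<delta> so that
      \<open>powr_compare_at_0\<close> applies. For R \<ge> 4 a translation by at most 2 keeps the
      ball of radius R/2 inside the ball of radius \<open>R\<close>, so the average there is
      1.\<close>
    define R where "R = 1 / \<delta>"
    have R: "4 \<le> R" using \<delta> by (simp add: R_def field_simps)
    have Rp: "R ^ d = \<delta> powr (- real d)"
      using \<delta> by (simp add: R_def powr_minus powr_realpow power_one_over inverse_eq_divide)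
    have "1 * (v * (R / 2) ^ d) powr m \<le> C * (v * R ^ d) powr s"
    proof (rule bound)
      show "emeasure lborel (ball (0::'a) R) \<le> ennreal (v * R ^ d)"
        "ennreal (v * (R / 2) ^ d) \<le> emeasure lborel (ball (0::'a) (R / 2))"
        using R by (simp_all add: emeasure_ball v_def d_def)
      fix x :: 'a assume x: "x \<in> ball 0 (R / 2)"
      have *: "x - t *\<^sub>R z \<in> ball 0 R" if "norm z \<le> 1" for z
      proof -
        have "norm (x - t *\<^sub>R z) \<le> norm x + t * norm z"
          using norm_triangle_ineq4[of x "t *\<^sub>R z"] t by simp
        also have "t * norm z \<le> 2 * 1" using t that by (intro mult_mono) auto
        finally show ?thesis using x R by simp
      qed
      have W: "{w. x - t *\<^sub>R fst w \<in> ball 0 R \<and> x - t *\<^sub>R snd w \<in> ball 0 R} \<in> sets (borel :: ('a \<times> 'a) measure)"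
        by (auto intro!: borel_open open_Collect_conj open_Collect_less continuous_intros simp: ball_def)
      have "sphere (0::'a \<times> 'a) 1 \<subseteq> {w. x - t *\<^sub>R fst w \<in> ball 0 R \<and> x - t *\<^sub>R snd w \<in> ball 0 R}"
      proof (intro subsetI CollectI conjI *)
        fix w :: "'a \<times> 'a" assume "w \<in> sphere 0 1"
        then show "norm (fst w) \<le> 1" "norm (snd w) \<le> 1"
          using norm_fst_le[of "fst w" "snd w"] norm_snd_le[of "snd w" "fst w"] by auto
      qed
      then have "1 \<le> measure sphere_measure {w. x - t *\<^sub>R fst w \<in> ball 0 R \<and> x - t *\<^sub>R snd w \<in> ball 0 R}"
        using finite_measure.finite_measure_mono[OF finite_measure_sphere_measure, of "sphere (0::'a \<times> 'a) 1"] W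
        by (simp add: measure_sphere_measure_sphere)
      then show "\<exists>t\<in>E. 1 \<le> measure sphere_measure {w. x - t *\<^sub>R fst w \<in> ball 0 R \<and> x - t *\<^sub>R snd w \<in> ball 0 R}"
        using t by blast
    qed (use v R in auto)
    moreover have "(v * (R / 2) ^ d) powr m = (v / 2 ^ d) powr m * \<delta> powr (- (real d * m))"
    proof -
      have "v * (R / 2) ^ d = v / 2 ^ d * \<delta> powr (- real d)" by (simp add: power_divide Rp)
      then show ?thesis using v by (simp only: powr_mult powr_powr minus_mult_left)
    qed
    moreover have "(v * R ^ d) powr s = v powr s * \<delta> powr (- (real d * s))"
      using v by (simp add: Rp powr_mult powr_powr)
    ultimately show ?thesis by simp
  qed
  then have "eventually (\<lambda>\<delta>. (v / 2 ^ d) powr m * \<delta> powr (- (real d * m)) \<le> (C * v powr s) * \<delta> powr (- (real d * s))) (at_right 0)"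
    using eventually_at_right_real[of 0 "1/4"] by (auto elim: eventually_mono)
  then have "- (real d * s) \<le> - (real d * m)"
    using v by (intro powr_compare_at_0[of "(v / 2 ^ d) powr m" _ "C * v powr s"] eventually_frequently) auto
  then show ?thesis by (simp add: m_def s_def d_def)
qed

lemma ball_example_bound:
  assumes bdd: "spherical_maximal_bounded TYPE('a::euclidean_space) E p q r" "0 < p" "0 < q" "0 < r"
    and E: "E \<subseteq> {1..2}" "E \<noteq> {}"
  obtains C where "C > 0" and "\<And>\<delta>. 0 < \<delta> \<Longrightarrow> \<delta> \<le> 1 / 4 \<Longrightarrow>
    (\<delta> ^ (DIM('a) - 1))\<^sup>2 * \<delta> * (real (covering_number E \<delta>) * \<delta>) powr recip r
      \<le> C * (\<delta> ^ DIM('a)) powr (recip p + recip q)"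
proof -
  define m s d where "m = recip r" and "s = recip p + recip q" and "d = DIM('a)"
  obtain C where C: "C > 0" and bound:
    "\<And>(F::'a set) H f h c. F \<in> sets borel \<Longrightarrow> H \<in> sets borel \<Longrightarrow>
      emeasure lborel F \<le> ennreal f \<Longrightarrow> ennreal h \<le> emeasure lborel H \<Longrightarrow> f > 0 \<Longrightarrow> h > 0 \<Longrightarrow> c \<ge> 0 \<Longrightarrow>
      (\<And>x. x \<in> H \<Longrightarrow> \<exists>t\<in>E. c \<le> measure sphere_measure {w. x - t *\<^sub>R fst w \<in> F \<and> x - t *\<^sub>R snd w \<in> F}) \<Longrightarrow>
      c * h powr m \<le> C * f powr s"
    unfolding m_def s_def using spherical_maximal_bounded_indicatorE[OF bdd] by blast
  obtain \<kappa> :: real where \<kappa>: "\<kappa> > 0" and patch: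
    "\<And>(e::'a) a \<eta>. norm e = 1 \<Longrightarrow> 0 < a \<Longrightarrow> a \<le> 1 \<Longrightarrow> 0 < \<eta> \<Longrightarrow> \<eta> \<le> 1 / 4 \<Longrightarrow>
      \<kappa> * (a ^ (d - 1))\<^sup>2 * \<eta> \<le> measure sphere_measure (cone_patch e a \<eta>)"
    unfolding d_def using sphere_measure_cone_patch_ge by blast
  define v where "v = unit_ball_vol (real d)"
  have v: "v > 0" by (simp add: v_def)
  define v' where "v' = v * (1 / sqrt 2) ^ d"
  have v': "v' > 0" using v by (simp add: v'_def)
  have main: "(\<delta> ^ (d - 1))\<^sup>2 * \<delta> * (real (covering_number E \<delta>) * \<delta>) powr m
      \<le> C * (v * 8 ^ d) powr s / (\<kappa> * v' powr m) * (\<delta> ^ d) powr s"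
    if \<delta>: "0 < \<delta>" "\<delta> \<le> 1 / 4" for \<delta>
  proof -
    let ?N = "real (covering_number E \<delta>)" and ?c = "\<kappa> * (\<delta> ^ (d - 1))\<^sup>2 * \<delta>"
    have N: "1 \<le> ?N" using covering_number_pos[OF E(1) \<delta>(1) E(2)] by simp
    have "?c * (?N * (v' * \<delta>)) powr m \<le> C * (v * (8 * \<delta>) ^ d) powr s"
    proof (rule bound)
      show "ball (0::'a) (8 * \<delta>) \<in> sets borel" by simp
      show "annular_cells E \<delta> \<in> sets (borel :: 'a measure)"
        using E \<delta> by (intro annular_cells_emeasure_ge)
      have "ennreal (?N * (v' * \<delta>)) \<le> ennreal (real (card (grid_cells E \<delta>)) * (v' * \<delta>))"
        using covering_number_le_card_grid_cells[OF E(1) \<delta>(1)] v' \<delta>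
        by (intro ennreal_leI mult_right_mono) auto
      also have "\<dots> \<le> emeasure lborel (annular_cells E \<delta> :: 'a set)"
        unfolding v'_def v_def d_def using E \<delta> by (intro annular_cells_emeasure_ge)
      finally show "ennreal (?N * (v' * \<delta>)) \<le> emeasure lborel (annular_cells E \<delta> :: 'a set)" .
      show "emeasure lborel (ball (0::'a) (8 * \<delta>)) \<le> ennreal (v * (8 * \<delta>) ^ d)"
        using \<delta> by (simp add: emeasure_ball v_def d_def)
      fix x :: 'a assume "x \<in> annular_cells E \<delta>"
      then obtain t where t: "t \<in> E" and x: "\<bar>norm x - t / sqrt 2\<bar> \<le> \<delta> / sqrt 2"
        using \<delta>(1) by (rule annular_cellsE)
      have t12: "1 \<le> t" "t \<le> 2" using t E by auto
      have "\<delta> / sqrt 2 < t / sqrt 2" using t12 \<delta> by (intro divide_strict_right_mono) auto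
      then have x0: "0 < norm x" using x by linarith
      \<comment> \<open>The axis follows the point \<open>x\<close>, which is nonzero since t \<ge>
        1 > \<delta>; this is harmless because the patch bound is uniform in the axis.\<close>
      define e where "e = x /\<^sub>R norm x"
      have e: "norm e = 1" and xe: "x = norm x *\<^sub>R e" using x0 by (auto simp: e_def)
      have "?c \<le> measure sphere_measure (cone_patch e \<delta> \<delta>)"
        using patch[OF e, of \<delta> \<delta>] \<delta> by simp
      also have "\<dots> \<le> measure sphere_measure {w. x - t *\<^sub>R fst w \<in> ball 0 (8 * \<delta>) \<and> x - t *\<^sub>R snd w \<in> ball 0 (8 * \<delta>)}"
        using ball_patch_geometry[OF e xe x] t12 \<delta> by (intro measure_patch_mono) auto
      finally show "\<exists>t\<in>E. ?c \<le> measure sphere_measure {w. x - t *\<^sub>R fst w \<in> ball 0 (8 * \<delta>) \<and> x - t *\<^sub>R snd w \<in> ball 0 (8 * \<delta>)}"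
        using t by blast
    qed (use v v' \<delta> N \<kappa> in auto)
    moreover have "(?N * (v' * \<delta>)) powr m = v' powr m * (?N * \<delta>) powr m"
      using v' \<delta> by (simp add: powr_mult mult_ac)
    moreover have "(v * (8 * \<delta>) ^ d) powr s = (v * 8 ^ d) powr s * (\<delta> ^ d) powr s"
      using v \<delta> by (simp add: powr_mult power_mult_distrib mult_ac)
    ultimately have "(\<kappa> * v' powr m) * ((\<delta> ^ (d - 1))\<^sup>2 * \<delta> * (?N * \<delta>) powr m) \<le> C * (v * 8 ^ d) powr s * (\<delta> ^ d) powr s"
      by (simp add: mult_ac)
    moreover have "0 < \<kappa> * v' powr m" using \<kappa> v' by simp
    ultimately show ?thesis by (simp add: pos_le_divide_eq mult.commute)
  qed
  show thesis
  proof (rule that[of "C * (v * 8 ^ d) powr s / (\<kappa> * v' powr m)"])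
    show "C * (v * 8 ^ d) powr s / (\<kappa> * v' powr m) > 0" using C v v' \<kappa> by simp
  qed (use main in \<open>simp add: m_def s_def d_def\<close>)
qed

text \<open>The Knapp type example with free parameters \<open>a\<close> and \<open>L\<close>. The
  lower bound on the covering number expresses that \<open>E\<close> meets the interval, which makes
  the volume bound \<open>h\<close> positive.\<close>

lemma cap_example_bound:
  assumes bdd: "spherical_maximal_bounded TYPE('a::euclidean_space) E p q r" "0 < p" "0 < q" "0 < r"
    and E: "E \<subseteq> {1..2}"
  obtains C where "C > 0" and "\<And>a L t0. 0 < a \<Longrightarrow> a \<le> 1 \<Longrightarrow> 0 < L \<Longrightarrow> L \<le> 1 / 10 \<Longrightarrow> a\<^sup>2 * L \<le> 1 / 100 \<Longrightarrow>
    1 \<le> t0 \<Longrightarrow> t0 \<le> 2 \<Longrightarrow> 1 \<le> covering_number (E \<inter> {t0..t0 + L}) (a\<^sup>2 * L) \<Longrightarrow>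
    (a ^ (DIM('a) - 1))\<^sup>2 * (a\<^sup>2 * L) *
      (real (covering_number (E \<inter> {t0..t0 + L}) (a\<^sup>2 * L)) * ((a * L) ^ (DIM('a) - 1) * (a\<^sup>2 * L))) powr recip r
      \<le> C * (a ^ (DIM('a) - 1) * (a\<^sup>2 * L)) powr (recip p + recip q)"
proof -
  define m s d where "m = recip r" and "s = recip p + recip q" and "d = DIM('a)"
  have d: "0 < d" by (simp add: d_def)
  obtain C where C: "C > 0" and bound:
    "\<And>(F::'a set) H f h c. F \<in> sets borel \<Longrightarrow> H \<in> sets borel \<Longrightarrow>
      emeasure lborel F \<le> ennreal f \<Longrightarrow> ennreal h \<le> emeasure lborel H \<Longrightarrow> f > 0 \<Longrightarrow> h > 0 \<Longrightarrow> c \<ge> 0 \<Longrightarrow>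
      (\<And>x. x \<in> H \<Longrightarrow> \<exists>t\<in>E. c \<le> measure sphere_measure {w. x - t *\<^sub>R fst w \<in> F \<and> x - t *\<^sub>R snd w \<in> F}) \<Longrightarrow>
      c * h powr m \<le> C * f powr s"
    unfolding m_def s_def using spherical_maximal_bounded_indicatorE[OF bdd] by blast
  obtain \<kappa> :: real where \<kappa>: "\<kappa> > 0" and patch:
    "\<And>(e::'a) a \<eta>. norm e = 1 \<Longrightarrow> 0 < a \<Longrightarrow> a \<le> 1 \<Longrightarrow> 0 < \<eta> \<Longrightarrow> \<eta> \<le> 1 / 4 \<Longrightarrow>
      \<kappa> * (a ^ (d - 1))\<^sup>2 * \<eta> \<le> measure sphere_measure (cone_patch e a \<eta>)"
    unfolding d_def using sphere_measure_cone_patch_ge by blast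
  define v where "v = unit_ball_vol (real d)"
  have v: "v > 0" by (simp add: v_def)
  \<comment> \<open>The shell has thickness 80\<delta> and outer radius at most 2, which gives the
    first factors through \<open>power_diff_le\<close>. The bracket is \<open>cone_vol_le\<close> at
    slope \<open>40 * a\<close>, with \<open>1 + 40 * a \<le> 41\<close>.\<close>
  define M where "M = real d * 80 * 2 ^ (d - 1) * (v * 2 ^ d * 41 * 40 ^ (d - 1))"
  have M: "M > 0" using v d by (simp add: M_def)
  define M' where "M' = (2 / real d) ^ (d - 1) / sqrt 2"
  have M': "M' > 0" using d by (simp add: M'_def)
  obtain e :: 'a where eB: "e \<in> Basis" using nonempty_Basis by blast
  then have e: "norm e = 1" by simp
  have main: "(a ^ (d - 1))\<^sup>2 * (a\<^sup>2 * L) *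
      (real (covering_number (E \<inter> {t0..t0 + L}) (a\<^sup>2 * L)) * ((a * L) ^ (d - 1) * (a\<^sup>2 * L))) powr m
      \<le> C * M powr s / (\<kappa> * M' powr m) * (a ^ (d - 1) * (a\<^sup>2 * L)) powr s"
    if a: "0 < a" "a \<le> 1" and L: "0 < L" "L \<le> 1 / 10" and \<delta>100: "a\<^sup>2 * L \<le> 1 / 100"
      and t0: "1 \<le> t0" "t0 \<le> 2" and N1: "1 \<le> covering_number (E \<inter> {t0..t0 + L}) (a\<^sup>2 * L)" for a L t0
  proof -
    define \<delta> where "\<delta> = a\<^sup>2 * L"
    have \<delta>: "0 < \<delta>" "\<delta> \<le> 1 / 100" using a L \<delta>100 by (auto simp: \<delta>_def)
    let ?I = "E \<inter> {t0..t0 + L}"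
    let ?N = "real (covering_number ?I \<delta>)" and ?c = "\<kappa> * (a ^ (d - 1))\<^sup>2 * \<delta>"
    define R1 R2 where "R1 = t0 / sqrt 2 - 40 * \<delta>" and "R2 = t0 / sqrt 2 + 40 * \<delta>"
    \<comment> \<open>The cone opens along \<open>- e\<close> because
      \<open>x - t *\<^sub>R y\<close> points away from \<open>e\<close>.\<close>
    let ?F = "{u \<in> axial_cone (- e) (40 * a). R1 < norm u \<and> norm u \<le> R2}"
    have "1 / sqrt 2 \<le> t0 / sqrt 2" "t0 / sqrt 2 \<le> 2 * (1 / sqrt 2)"
      using t0 by (auto intro: divide_right_mono)
    then have k: "7 / 10 \<le> t0 / sqrt 2" "t0 / sqrt 2 \<le> 142 / 100"
      using inverse_sqrt2_bounds by linarith+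
    have R: "0 \<le> R1" "R1 \<le> R2" "R2 \<le> 2" "R2 - R1 = 80 * \<delta>"
      using k \<delta> unfolding R1_def R2_def by linarith+
    have sI: "?I \<subseteq> {1..2}" using E by auto
    have N: "1 \<le> ?N" using N1 by (simp add: \<delta>_def)
    have adp: "0 < a ^ (d - 1) * \<delta>" using a \<delta> by simp
    define h where "h = M' * (?N * ((a * L) ^ (d - 1) * \<delta>))"
    have h0: "h > 0" unfolding h_def using M' N a L \<delta> by (intro mult_pos_pos) auto
    have "?c * h powr m \<le> C * (M * (a ^ (d - 1) * \<delta>)) powr s"
    proof (rule bound)
      show "?F \<in> sets borel" by measurable
      have "emeasure lborel ?F = ennreal ((R2 ^ d - R1 ^ d) * cone_vol (- e) (40 * a))"
        unfolding d_def using R by (intro emeasure_cone_shell) auto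
      also have "\<dots> \<le> ennreal (M * (a ^ (d - 1) * \<delta>))"
      proof (rule ennreal_leI)
        have "R2 ^ d - R1 ^ d \<le> real d * (R2 - R1) * R2 ^ (d - 1)"
          using R by (intro power_diff_le) auto
        also have "\<dots> \<le> real d * (80 * \<delta>) * 2 ^ (d - 1)"
          unfolding R(4) using R \<delta> by (intro mult_left_mono power_mono) auto
        finally have 1: "R2 ^ d - R1 ^ d \<le> real d * (80 * \<delta>) * 2 ^ (d - 1)" .
        have "cone_vol (- e) (40 * a) \<le> v * 2 ^ d * (1 + 40 * a) * (40 * a) ^ (d - 1)"
          unfolding v_def d_def using e a by (intro cone_vol_le) auto
        also have "\<dots> \<le> v * 2 ^ d * 41 * (40 * a) ^ (d - 1)"
          using a v by (intro mult_right_mono mult_left_mono) auto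
        finally have 2: "cone_vol (- e) (40 * a) \<le> v * 2 ^ d * 41 * (40 * a) ^ (d - 1)" .
        have "(R2 ^ d - R1 ^ d) * cone_vol (- e) (40 * a)
          \<le> (real d * (80 * \<delta>) * 2 ^ (d - 1)) * (v * 2 ^ d * 41 * (40 * a) ^ (d - 1))"
          using 1 2 \<delta> by (intro mult_mono) auto
        also have "\<dots> = M * (a ^ (d - 1) * \<delta>)" by (simp add: M_def power_mult_distrib)
        finally show "(R2 ^ d - R1 ^ d) * cone_vol (- e) (40 * a) \<le> M * (a ^ (d - 1) * \<delta>)" .
      qed
      finally show "emeasure lborel ?F \<le> ennreal (M * (a ^ (d - 1) * \<delta>))" .
      have \<rho>: "0 < a * L / real d" using a L d by simp
      note slab = slab_cells_emeasure_ge[OF sI \<delta>(1) eB \<rho>, of t0, folded d_def]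
      show "slab_cells e (a * L / real d) t0 ?I \<delta> \<in> sets borel" by (fact slab(1))
      have "h = ?N * ((2 * (a * L / real d)) ^ (d - 1) * (\<delta> / sqrt 2))"
        by (simp add: h_def M'_def power_mult_distrib power_divide)
      also have "\<dots> \<le> real (card (grid_cells ?I \<delta>)) * ((2 * (a * L / real d)) ^ (d - 1) * (\<delta> / sqrt 2))"
        using covering_number_le_card_grid_cells[OF sI \<delta>(1)] \<delta> a L
        by (intro mult_right_mono) auto
      finally show "ennreal h \<le> emeasure lborel (slab_cells e (a * L / real d) t0 ?I \<delta>)"
        using slab(2) by (meson ennreal_leI order.trans)
      fix x assume "x \<in> slab_cells e (a * L / real d) t0 ?I \<delta>"
      then obtain t where t: "t \<in> ?I" and x: "\<bar>x \<bullet> e - (t - t0) / sqrt 2\<bar> \<le> \<delta>"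
        "norm (x - (x \<bullet> e) *\<^sub>R e) \<le> DIM('a) * (a * L / real d)"
        using \<delta>(1) eB \<rho> by (elim slab_cellsE) auto
      have x2: "norm (x - (x \<bullet> e) *\<^sub>R e) \<le> a * L" using x(2) by (simp add: d_def)
      have "t \<le> 2" using t sI by auto
      have "?c \<le> measure sphere_measure (cone_patch e a \<delta>)"
        using patch[OF e a, of \<delta>] \<delta> by simp
      also have "\<dots> \<le> measure sphere_measure {w. x - t *\<^sub>R fst w \<in> ?F \<and> x - t *\<^sub>R snd w \<in> ?F}"
      proof (rule measure_patch_mono)
        fix y assume "y \<in> axial_cone e a" "\<bar>norm y - 1 / sqrt 2\<bar> \<le> \<delta>"
        then show "x - t *\<^sub>R y \<in> ?F"
          unfolding R1_def R2_def \<delta>_def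
          using e a L \<delta>100 t0 t \<open>t \<le> 2\<close> x(1) x2
          by (intro cap_patch_geometry) (auto simp: \<delta>_def)
      qed measurable
      finally show "\<exists>t\<in>E. ?c \<le> measure sphere_measure {w. x - t *\<^sub>R fst w \<in> ?F \<and> x - t *\<^sub>R snd w \<in> ?F}"
        using t by blast
    qed (use M adp h0 \<kappa> \<delta> in auto)
    moreover have "h powr m = M' powr m * (?N * ((a * L) ^ (d - 1) * \<delta>)) powr m"
      unfolding h_def by (rule powr_mult)
    moreover have "(M * (a ^ (d - 1) * \<delta>)) powr s = M powr s * (a ^ (d - 1) * \<delta>) powr s"
      by (rule powr_mult)
    ultimately have "(\<kappa> * M' powr m) * ((a ^ (d - 1))\<^sup>2 * \<delta> * (?N * ((a * L) ^ (d - 1) * \<delta>)) powr m)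
        \<le> C * M powr s * (a ^ (d - 1) * \<delta>) powr s"
      by (simp add: mult_ac)
    moreover have "0 < \<kappa> * M' powr m" using \<kappa> M' by simp
    ultimately show ?thesis unfolding \<delta>_def by (simp add: pos_le_divide_eq mult.commute)
  qed
  show thesis
  proof (rule that[of "C * M powr s / (\<kappa> * M' powr m)"])
    show "C * M powr s / (\<kappa> * M' powr m) > 0" using C M M' \<kappa> by simp
  qed (use main in \<open>simp add: m_def s_def d_def\<close>)
qed

section \<open>Comparison of exponents\<close>

lemma frequently_less_of_less_Limsup:
  fixes f :: "real \<Rightarrow> ereal"
  assumes "c < Limsup F f"
  shows "\<exists>\<^sub>F x in F. c < f x"
proof (rule ccontr)
  assume "\<not> ?thesis"
  then have "eventually (\<lambda>x. f x \<le> c) F" by (simp add: not_frequently not_less)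
  then have "Limsup F f \<le> c" by (rule Limsup_bounded)
  with assms show False by simp
qed

lemma frequently_at_right_mp:
  assumes "\<exists>\<^sub>F \<delta> in at_right (0::real). P \<delta>" "eventually Q (at_right 0)" "\<And>\<delta>. P \<delta> \<Longrightarrow> Q \<delta> \<Longrightarrow> R \<delta>"
  shows "\<exists>\<^sub>F \<delta> in at_right 0. R \<delta>"
proof -
  have "eventually (\<lambda>\<delta>. P \<delta> \<longrightarrow> R \<delta>) (at_right 0)"
    using assms(2) by eventually_elim (use assms(3) in blast)
  then show ?thesis by (rule frequently_rev_mp[OF assms(1)])
qed

section \<open>Elementary facts on the dimensions\<close>

lemma minkowski_dim_nonneg:
  assumes E: "E \<subseteq> {1..2}" "E \<noteq> {}"
  shows "0 \<le> minkowski_dim E"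
  unfolding minkowski_dim_def
proof (rule le_Limsup)
  show "eventually (\<lambda>\<delta>. 0 \<le> ereal (ln (real (covering_number E \<delta>)) / ln (1 / \<delta>))) (at_right 0)"
    using eventually_at_right_real[OF zero_less_one]
  proof eventually_elim
    case (elim \<delta>)
    then have "1 \<le> covering_number E \<delta>" using E by (intro covering_number_pos) auto
    then show ?case using elim by simp
  qed
qed simp

text \<open>For \<open>\<theta> = 0\<close> the intervals have length 1, and the only such interval
  inside [1,2] is [1,2] itself. This is what later links regularity to the Minkowski
  dimension.\<close>

lemma assouad_spectrum_0:
  assumes E: "E \<subseteq> {1..2}"
  shows "assouad_spectrum 0 E = minkowski_dim E"
  unfolding assouad_spectrum_def minkowski_dim_def
proof (rule Limsup_eq)
  have ab: "{(a, b). 1 \<le> a \<and> a \<le> b \<and> b \<le> 2 \<and> b - a = (1::real)} = {(1, 2)}" by auto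
  have EI: "E \<inter> {1..2} = E" using E by auto
  show "eventually (\<lambda>\<delta>. (SUP (a, b) \<in> {(a, b). 1 \<le> a \<and> a \<le> b \<and> b \<le> 2 \<and> b - a = \<delta> powr 0}.
         ereal (ln (real (covering_number (E \<inter> {a..b}) \<delta>)) / ln ((b - a) / \<delta>))) =
      ereal (ln (real (covering_number E \<delta>)) / ln (1 / \<delta>))) (at_right 0)"
    using eventually_at_right_less[of 0]
  proof eventually_elim
    case (elim \<delta>)
    then show ?case by (simp add: ab EI)
  qed
qed

lemma ln_ratio_gt_imp_powr_le:
  fixes n :: nat and X c :: real
  assumes "c < ln (real n) / ln X" "1 < X" "0 < n"
  shows "X powr c \<le> real n"
proof -
  have "c * ln X \<le> ln (real n)" using assms by (simp add: pos_less_divide_eq)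
  then have "exp (c * ln X) \<le> exp (ln (real n))" by simp
  then show ?thesis using assms by (simp add: powr_def)
qed

section \<open>The upper bounds for the sum of the reciprocals\<close>

lemma recip_add_le_first:
  assumes bdd: "spherical_maximal_bounded TYPE('a::euclidean_space) E p q r" "0 < p" "0 < q" "0 < r"
    and E: "E \<subseteq> {1..2}" "E \<noteq> {}" and \<beta>: "minkowski_dim E = ereal \<beta>"
  shows "real DIM('a) * (recip p + recip q) \<le> 2 * real DIM('a) - 1 + (1 - \<beta>) * recip r"
proof -
  define m s d where "m = recip r" and "s = recip p + recip q" and "d = DIM('a)"
  have m: "m \<ge> 0" by (simp add: m_def)
  have d: "1 \<le> d" by (simp add: d_def Suc_leI)
  obtain C where C: "C > 0" and bound: "\<And>\<delta>. 0 < \<delta> \<Longrightarrow> \<delta> \<le> 1 / 4 \<Longrightarrow>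
    (\<delta> ^ (d - 1))\<^sup>2 * \<delta> * (real (covering_number E \<delta>) * \<delta>) powr m \<le> C * (\<delta> ^ d) powr s"
    unfolding m_def s_def d_def using ball_example_bound[OF bdd E] by blast
  \<comment> \<open>The upper limit gives a covering number of at least
    \<open>\<delta> powr (- (\<beta> - \<epsilon>))\<close> at arbitrarily small scales; inserting
    this in the ball example leaves an error linear in \<epsilon>.\<close>
  have "real d * s \<le> (2 * real d - 1 + (1 - \<beta>) * m) + m * \<epsilon>" if \<epsilon>: "0 < \<epsilon>" for \<epsilon>
  proof -
    have "\<exists>\<^sub>F \<delta> in at_right 0. ereal (\<beta> - \<epsilon>) < ereal (ln (real (covering_number E \<delta>)) / ln (1 / \<delta>))"
      using \<epsilon> \<beta> by (intro frequently_less_of_less_Limsup) (simp add: minkowski_dim_def)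
    then have "\<exists>\<^sub>F \<delta> in at_right 0. 1 * \<delta> powr (2 * real d - 1 + (1 - \<beta> + \<epsilon>) * m) \<le> C * \<delta> powr (real d * s)"
    proof (rule frequently_at_right_mp)
      show "eventually (\<lambda>\<delta>::real. \<delta> \<in> {0<..<1/4}) (at_right 0)"
        by (rule eventually_at_right_real) simp
      fix \<delta> :: real assume \<delta>: "\<delta> \<in> {0<..<1/4}"
        and c: "ereal (\<beta> - \<epsilon>) < ereal (ln (real (covering_number E \<delta>)) / ln (1 / \<delta>))"
      let ?N = "covering_number E \<delta>"
      have "1 \<le> ?N" using \<delta> E by (intro covering_number_pos) auto
      then have "(1 / \<delta>) powr (\<beta> - \<epsilon>) \<le> real ?N"
        using c \<delta> by (intro ln_ratio_gt_imp_powr_le) (auto simp: field_simps)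
      moreover have "(1 / \<delta>) powr (\<beta> - \<epsilon>) = \<delta> powr (- (\<beta> - \<epsilon>))"
        by (simp only: powr_minus powr_divide powr_one_eq_one inverse_eq_divide)
      ultimately have "\<delta> powr (- (\<beta> - \<epsilon>)) * \<delta> powr 1 \<le> real ?N * \<delta>"
        using \<delta> by (intro mult_mono) auto
      moreover have "\<delta> powr (- (\<beta> - \<epsilon>)) * \<delta> powr 1 = \<delta> powr (1 - \<beta> + \<epsilon>)"
        unfolding powr_add[symmetric] by (rule arg_cong) simp
      ultimately have "(\<delta> powr (1 - \<beta> + \<epsilon>)) powr m \<le> (real ?N * \<delta>) powr m"
        using m by (intro powr_mono2) (simp_all only: powr_ge_zero)
      then have "(\<delta> ^ (d - 1))\<^sup>2 * \<delta> * \<delta> powr ((1 - \<beta> + \<epsilon>) * m) \<le> (\<delta> ^ (d - 1))\<^sup>2 * \<delta> * (real ?N * \<delta>) powr m"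
        using \<delta> by (intro mult_left_mono) (auto simp: powr_powr)
      also have "\<dots> \<le> C * (\<delta> ^ d) powr s" using \<delta> by (intro bound) auto
      also have "(\<delta> ^ d) powr s = \<delta> powr (real d * s)"
        using \<delta> by (simp add: powr_powr flip: powr_realpow)
      also have "(\<delta> ^ (d - 1))\<^sup>2 * \<delta> = \<delta> powr (2 * real d - 1)"
      proof -
        have "(\<delta> ^ (d - 1))\<^sup>2 * \<delta> = \<delta> ^ (2 * d - 1)"
          using d by (cases d) (simp_all add: power_mult[symmetric] mult.commute)
        also have "\<dots> = \<delta> powr real (2 * d - 1)" using \<delta> by (simp add: powr_realpow)
        also have "real (2 * d - 1) = 2 * real d - 1" using d by (simp add: of_nat_diff)
        finally show ?thesis .
      qed
      finally show "1 * \<delta> powr (2 * real d - 1 + (1 - \<beta> + \<epsilon>) * m) \<le> C * \<delta> powr (real d * s)"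
        by (simp add: powr_add)
    qed
    then have "real d * s \<le> 2 * real d - 1 + (1 - \<beta> + \<epsilon>) * m"
      by (rule powr_compare_at_0) simp
    then show ?thesis by (simp add: algebra_simps)
  qed
  then have "real d * s \<le> 2 * real d - 1 + (1 - \<beta>) * m"
    by (rule le_add_mult_epsilon[of 1, rotated]) auto
  then show ?thesis by (simp add: m_def s_def d_def)
qed

text \<open>The choice \<open>L = \<delta>\<^sup>\<theta>\<close>, \<open>a = \<delta>\<^bsup>(1 - \<theta>)/2\<^esup>\<close> turns \<open>a\<^sup>2 L\<close> into \<open>\<delta>\<close> and \<open>a L\<close> into \<open>\<delta>\<^bsup>(1 + \<theta>)/2\<^esup>\<close>.\<close>

lemma cap_example_exponents:
  assumes bdd: "spherical_maximal_bounded TYPE('a::euclidean_space) E p q r" "0 < p" "0 < q" "0 < r"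
    and E: "E \<subseteq> {1..2}" and \<theta>: "0 < \<theta>" "\<theta> \<le> 1"
    and fr: "\<exists>\<^sub>F \<delta> in at_right 0. \<exists>t0. 1 \<le> t0 \<and> t0 \<le> 2 \<and>
      1 \<le> covering_number (E \<inter> {t0..t0 + \<delta> powr \<theta>}) \<delta> \<and>
      \<delta> powr (- \<nu>) \<le> real (covering_number (E \<inter> {t0..t0 + \<delta> powr \<theta>}) \<delta>)"
  defines "d \<equiv> real DIM('a)"
  shows "((1 - \<theta>) / 2 * (d - 1) + 1) * (recip p + recip q)
    \<le> (1 - \<theta>) * (d - 1) + 1 + ((1 + \<theta>) / 2 * (d - 1) + 1 - \<nu>) * recip r"
proof -
  define m s n where "m = recip r" and "s = recip p + recip q" and "n = DIM('a) - 1"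
  have m: "m \<ge> 0" by (simp add: m_def)
  have n: "real n = d - 1" unfolding n_def d_def by (simp add: of_nat_diff Suc_leI)
  obtain C where C: "C > 0" and bound: "\<And>a L t0. 0 < a \<Longrightarrow> a \<le> 1 \<Longrightarrow> 0 < L \<Longrightarrow> L \<le> 1 / 10 \<Longrightarrow> a\<^sup>2 * L \<le> 1 / 100 \<Longrightarrow>
    1 \<le> t0 \<Longrightarrow> t0 \<le> 2 \<Longrightarrow> 1 \<le> covering_number (E \<inter> {t0..t0 + L}) (a\<^sup>2 * L) \<Longrightarrow>
    (a ^ n)\<^sup>2 * (a\<^sup>2 * L) *
      (real (covering_number (E \<inter> {t0..t0 + L}) (a\<^sup>2 * L)) * ((a * L) ^ n * (a\<^sup>2 * L))) powr m
      \<le> C * (a ^ n * (a\<^sup>2 * L)) powr s"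
    unfolding m_def s_def n_def using cap_example_bound[OF bdd E] by blast
  have "\<exists>\<^sub>F \<delta> in at_right 0. 1 * \<delta> powr ((1 - \<theta>) * n + 1 + ((1 + \<theta>) / 2 * n + 1 - \<nu>) * m)
      \<le> C * \<delta> powr (((1 - \<theta>) / 2 * n + 1) * s)"
  proof (rule frequently_at_right_mp[OF fr])
    have "((\<lambda>\<delta>::real. \<delta> powr \<theta>) \<longlongrightarrow> 0) (at_right 0)" using \<theta> by real_asymp
    then have "eventually (\<lambda>\<delta>::real. \<delta> powr \<theta> < 1 / 10) (at_right 0)"
      by (rule order_tendstoD(2)) simp
    moreover have "eventually (\<lambda>\<delta>::real. \<delta> \<in> {0<..<1/100}) (at_right 0)"
      by (rule eventually_at_right_real) simp
    ultimately show "eventually (\<lambda>\<delta>::real. \<delta> powr \<theta> < 1 / 10 \<and> \<delta> \<in> {0<..<1/100}) (at_right 0)"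
      by (rule eventually_conj)
    fix \<delta> :: real
    assume \<delta>L: "\<delta> powr \<theta> < 1 / 10 \<and> \<delta> \<in> {0<..<1/100}"
    then have \<delta>: "0 < \<delta>" "\<delta> < 1 / 100" and L10: "\<delta> powr \<theta> < 1 / 10" by auto
    define L a where "L = \<delta> powr \<theta>" and "a = \<delta> powr ((1 - \<theta>) / 2)"
    assume "\<exists>t0. 1 \<le> t0 \<and> t0 \<le> 2 \<and>
      1 \<le> covering_number (E \<inter> {t0..t0 + \<delta> powr \<theta>}) \<delta> \<and>
      \<delta> powr (- \<nu>) \<le> real (covering_number (E \<inter> {t0..t0 + \<delta> powr \<theta>}) \<delta>)"
    then obtain t0 where t0: "1 \<le> t0" "t0 \<le> 2"
      and N: "1 \<le> covering_number (E \<inter> {t0..t0 + L}) \<delta>"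
        "\<delta> powr (- \<nu>) \<le> real (covering_number (E \<inter> {t0..t0 + L}) \<delta>)"
      unfolding L_def by blast
    let ?N = "real (covering_number (E \<inter> {t0..t0 + L}) \<delta>)"
    have pw: "(\<delta> powr x) ^ k = \<delta> powr (x * real k)" for x k
      using \<delta> by (simp add: powr_powr flip: powr_realpow)
    have a: "0 < a" "a \<le> 1" and L: "0 < L" "L \<le> 1 / 10"
      using \<delta> \<theta> L10 by (auto simp: a_def L_def intro!: powr_le1)
    have aL: "a * L = \<delta> powr ((1 + \<theta>) / 2)"
      unfolding a_def L_def by (simp flip: powr_add add: field_simps)
    have a2: "a\<^sup>2 = \<delta> powr (1 - \<theta>)" unfolding a_def pw by (rule arg_cong) simp
    have a2L: "a\<^sup>2 * L = \<delta>" unfolding a2 L_def using \<delta> by (simp flip: powr_add)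
    have an: "a ^ n = \<delta> powr ((1 - \<theta>) / 2 * n)" unfolding a_def by (rule pw)
    have an2: "(a ^ n)\<^sup>2 * \<delta> = \<delta> powr ((1 - \<theta>) * n + 1)"
      using \<delta> by (simp add: an pw powr_add)
    have aLn: "(a * L) ^ n * \<delta> = \<delta> powr ((1 + \<theta>) / 2 * n + 1)"
      using \<delta> by (simp add: aL pw powr_add)
    have "\<delta> powr (- \<nu>) * ((a * L) ^ n * \<delta>) \<le> ?N * ((a * L) ^ n * \<delta>)"
      using N(2) a L \<delta> by (intro mult_right_mono) auto
    then have "\<delta> powr ((1 + \<theta>) / 2 * n + 1 - \<nu>) \<le> ?N * ((a * L) ^ n * \<delta>)"
      unfolding aLn by (simp flip: powr_add add: algebra_simps)
    then have "(\<delta> powr ((1 + \<theta>) / 2 * n + 1 - \<nu>)) powr m \<le> (?N * ((a * L) ^ n * \<delta>)) powr m"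
      using m by (intro powr_mono2) auto
    then have "(a ^ n)\<^sup>2 * \<delta> * \<delta> powr (((1 + \<theta>) / 2 * n + 1 - \<nu>) * m) \<le>
      (a ^ n)\<^sup>2 * \<delta> * (?N * ((a * L) ^ n * \<delta>)) powr m"
      using \<delta> by (intro mult_left_mono) (auto simp: powr_powr)
    also have "\<dots> \<le> C * (a ^ n * \<delta>) powr s"
      using bound[of a L t0] a L t0 N(1) \<delta> unfolding a2L by simp
    also have "a ^ n * \<delta> = \<delta> powr ((1 - \<theta>) / 2 * n + 1)"
      using \<delta> by (simp add: an powr_add)
    finally show "1 * \<delta> powr ((1 - \<theta>) * n + 1 + ((1 + \<theta>) / 2 * n + 1 - \<nu>) * m)
      \<le> C * \<delta> powr (((1 - \<theta>) / 2 * n + 1) * s)"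
      unfolding an2 powr_powr
      by (simp only: powr_add[of \<delta> "(1 - \<theta>) * real n + 1"] mult_1)
  qed
  then have "((1 - \<theta>) / 2 * n + 1) * s \<le> (1 - \<theta>) * n + 1 + ((1 + \<theta>) / 2 * n + 1 - \<nu>) * m"
    by (rule powr_compare_at_0) simp
  then show ?thesis by (simp only: n m_def s_def)
qed

text \<open>The cap example with \<open>\<theta> = 1\<close> and \<open>\<nu> = 0\<close>, that is
  \<open>a = 1\<close> and \<open>L = \<delta>\<close>. A single point of \<open>E\<close> suffices,
  so no dimension enters.\<close>

lemma recip_add_le_third:
  assumes bdd: "spherical_maximal_bounded TYPE('a::euclidean_space) E p q r" "0 < p" "0 < q" "0 < r"
    and E: "E \<subseteq> {1..2}" "E \<noteq> {}"
  shows "recip p + recip q \<le> 1 + real DIM('a) * recip r"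
proof -
  obtain t0 where t0: "t0 \<in> E" using E by blast
  have "((1 - 1) / 2 * (real DIM('a) - 1) + 1) * (recip p + recip q)
    \<le> (1 - 1) * (real DIM('a) - 1) + 1 + ((1 + 1) / 2 * (real DIM('a) - 1) + 1 - 0) * recip r"
  proof (rule cap_example_exponents[OF bdd E(1)])
    have "eventually (\<lambda>\<delta>. \<exists>t0. 1 \<le> t0 \<and> t0 \<le> 2 \<and>
      1 \<le> covering_number (E \<inter> {t0..t0 + \<delta> powr 1}) \<delta> \<and>
      \<delta> powr (- 0) \<le> real (covering_number (E \<inter> {t0..t0 + \<delta> powr 1}) \<delta>)) (at_right (0::real))"
      using eventually_at_right_less[of 0]
    proof eventually_elim
      case (elim \<delta>)
      have "1 \<le> covering_number (E \<inter> {t0..t0 + \<delta> powr 1}) \<delta>"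
        using E t0 elim by (intro covering_number_pos) auto
      moreover have "1 \<le> t0" "t0 \<le> 2" using t0 E by auto
      ultimately show ?case using elim by (intro exI[of _ t0]) auto
    qed
    then show "\<exists>\<^sub>F \<delta> in at_right 0. \<exists>t0. 1 \<le> t0 \<and> t0 \<le> 2 \<and>
      1 \<le> covering_number (E \<inter> {t0..t0 + \<delta> powr 1}) \<delta> \<and>
      \<delta> powr (- 0) \<le> real (covering_number (E \<inter> {t0..t0 + \<delta> powr 1}) \<delta>)"
      by (rule eventually_frequently[rotated]) simp
  qed simp_all
  then show ?thesis by simp
qed

text \<open>Since |I|/\<delta> = \<open>\<delta> powr (\<theta> - 1)\<close>, the spectrum provides
  intervals whose covering number has exponent
  \<open>\<nu> = (1 - \<theta>) * (\<gamma> - \<epsilon>)\<close> in the cap example.\<close>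

lemma recip_add_le_spectrum:
  assumes bdd: "spherical_maximal_bounded TYPE('a::euclidean_space) E p q r" "0 < p" "0 < q" "0 < r"
    and E: "E \<subseteq> {1..2}" and \<theta>: "0 < \<theta>" "\<theta> < 1"
    and \<gamma>: "assouad_spectrum \<theta> E = ereal \<gamma>" "\<gamma> > 0"
  defines "d \<equiv> real DIM('a)"
  shows "((1 - \<theta>) / 2 * (d - 1) + 1) * (recip p + recip q)
    \<le> (1 - \<theta>) * (d - 1) + 1 + ((1 + \<theta>) / 2 * (d - 1) + 1 - (1 - \<theta>) * \<gamma>) * recip r"
proof (rule le_add_mult_epsilon[OF \<gamma>(2)])
  fix \<epsilon> :: real assume \<epsilon>: "0 < \<epsilon>" "\<epsilon> < \<gamma>"
  have "\<exists>\<^sub>F \<delta> in at_right 0. ereal (\<gamma> - \<epsilon>) < (SUP (a, b) \<in> {(a, b). 1 \<le> a \<and> a \<le> b \<and> b \<le> 2 \<and> b - a = \<delta> powr \<theta>}.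
         ereal (ln (real (covering_number (E \<inter> {a..b}) \<delta>)) / ln ((b - a) / \<delta>)))"
    using \<gamma>(1) \<epsilon> by (intro frequently_less_of_less_Limsup) (simp add: assouad_spectrum_def)
  then have "\<exists>\<^sub>F \<delta> in at_right 0. \<exists>t0. 1 \<le> t0 \<and> t0 \<le> 2 \<and>
      1 \<le> covering_number (E \<inter> {t0..t0 + \<delta> powr \<theta>}) \<delta> \<and>
      \<delta> powr (- ((1 - \<theta>) * (\<gamma> - \<epsilon>))) \<le> real (covering_number (E \<inter> {t0..t0 + \<delta> powr \<theta>}) \<delta>)"
  proof (rule frequently_at_right_mp)
    show "eventually (\<lambda>\<delta>::real. \<delta> \<in> {0<..<1}) (at_right 0)"
      by (rule eventually_at_right_real) simp
    fix \<delta> :: real assume \<delta>: "\<delta> \<in> {0<..<1}"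
    assume "ereal (\<gamma> - \<epsilon>) < (SUP (a, b) \<in> {(a, b). 1 \<le> a \<and> a \<le> b \<and> b \<le> 2 \<and> b - a = \<delta> powr \<theta>}.
         ereal (ln (real (covering_number (E \<inter> {a..b}) \<delta>)) / ln ((b - a) / \<delta>)))"
    then obtain a b where ab: "1 \<le> a" "a \<le> b" "b \<le> 2" "b - a = \<delta> powr \<theta>"
      and c: "\<gamma> - \<epsilon> < ln (real (covering_number (E \<inter> {a..b}) \<delta>)) / ln ((b - a) / \<delta>)"
      by (auto simp: less_SUP_iff)
    have b: "b = a + \<delta> powr \<theta>" using ab(4) by simp
    let ?N = "covering_number (E \<inter> {a..a + \<delta> powr \<theta>}) \<delta>"
    have q: "(b - a) / \<delta> = \<delta> powr (\<theta> - 1)" using \<delta> ab(4) by (simp add: powr_diff)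
    \<comment> \<open>For an empty intersection the quotient would be 0 because
      \<open>ln 0 = 0\<close>; this is excluded by \<epsilon> < \<gamma>.\<close>
    have "?N \<noteq> 0" using c \<epsilon> by (auto simp: b intro: ccontr)
    then have N: "1 \<le> ?N" by simp
    have "1 < \<delta> powr (\<theta> - 1)"
    proof -
      have "\<delta> powr 0 < \<delta> powr (\<theta> - 1)" using \<delta> \<theta> by (intro powr_less_mono') auto
      then show ?thesis using \<delta> by simp
    qed
    then have "(\<delta> powr (\<theta> - 1)) powr (\<gamma> - \<epsilon>) \<le> real ?N"
      using c N unfolding q by (intro ln_ratio_gt_imp_powr_le) (auto simp: b)
    then have "\<delta> powr (- ((1 - \<theta>) * (\<gamma> - \<epsilon>))) \<le> real ?N"
      by (simp add: powr_powr minus_mult_left)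
    with N ab show "\<exists>t0. 1 \<le> t0 \<and> t0 \<le> 2 \<and> 1 \<le> covering_number (E \<inter> {t0..t0 + \<delta> powr \<theta>}) \<delta> \<and>
      \<delta> powr (- ((1 - \<theta>) * (\<gamma> - \<epsilon>))) \<le> real (covering_number (E \<inter> {t0..t0 + \<delta> powr \<theta>}) \<delta>)"
      by (intro exI[of _ a]) auto
  qed
  then have "((1 - \<theta>) / 2 * (d - 1) + 1) * (recip p + recip q)
    \<le> (1 - \<theta>) * (d - 1) + 1 + ((1 + \<theta>) / 2 * (d - 1) + 1 - (1 - \<theta>) * (\<gamma> - \<epsilon>)) * recip r"
    unfolding d_def using \<theta> by (intro cap_example_exponents[OF bdd E]) auto
  then show "((1 - \<theta>) / 2 * (d - 1) + 1) * (recip p + recip q)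
    \<le> (1 - \<theta>) * (d - 1) + 1 + ((1 + \<theta>) / 2 * (d - 1) + 1 - (1 - \<theta>) * \<gamma>) * recip r
      + (1 - \<theta>) * recip r * \<epsilon>"
    by (simp add: algebra_simps)
qed

text \<open>If \<beta> > \<gamma>, the threshold 1 - \<beta>/\<gamma> is negative, so regularity
  covers \<theta> = 0. There the spectrum is the Minkowski dimension, which gives \<beta> =
  \<gamma>, a contradiction.\<close>

lemma assouad_regular_minkowski_le:
  assumes "E \<subseteq> {1..2}" "assouad_regular E" "minkowski_dim E = ereal \<beta>" "assouad_dim E = ereal \<gamma>" "\<gamma> > 0"
  shows "\<beta> \<le> \<gamma>"
proof (rule ccontr)
  assume "\<not> ?thesis"
  then have "1 - \<beta> / \<gamma> < 0" using assms(5) by (simp add: field_simps)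
  then have "1 - minkowski_dim E / assouad_dim E < ereal 0"
    using assms(3-5) by (simp add: one_ereal_def)
  then have "assouad_spectrum 0 E = assouad_dim E"
    using assms(2) unfolding assouad_regular_def by force
  then have "\<beta> = \<gamma>" using assms assouad_spectrum_0[of E] by simp
  with \<open>\<not> ?thesis\<close> show False by simp
qed

text \<open>Regularity gives the spectrum only strictly above the threshold 1 - \<beta>/\<gamma>, so
  the bound from \<open>recip_add_le_spectrum\<close> is carried to the threshold by a
  limit.\<close>

lemma recip_add_le_second:
  assumes bdd: "spherical_maximal_bounded TYPE('a::euclidean_space) E p q r" "0 < p" "0 < q" "0 < r"
    and E: "E \<subseteq> {1..2}" "E \<noteq> {}" and reg: "assouad_regular E"
    and \<beta>: "minkowski_dim E = ereal \<beta>" and \<gamma>: "assouad_dim E = ereal \<gamma>" "\<gamma> > 0"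
  defines "d \<equiv> real DIM('a)"
  shows "recip p + recip q \<le> 1 + (\<beta> * (d - 1) / (\<beta> * (d - 1) + 2 * \<gamma>)
       + ((d - \<beta>) * 2 * \<gamma> - (d - 1) * \<beta>) / (\<beta> * (d - 1) + 2 * \<gamma>) * recip r)"
proof -
  define m s where "m = recip r" and "s = recip p + recip q"
  have \<beta>0: "0 \<le> \<beta>" using minkowski_dim_nonneg[OF E] \<beta> by simp
  have \<beta>\<gamma>: "\<beta> \<le> \<gamma>" by (rule assouad_regular_minkowski_le[OF E(1) reg \<beta> \<gamma>])
  have d: "1 \<le> d" by (simp add: d_def Suc_leI)
  define D where "D = \<beta> * (d - 1) + 2 * \<gamma>"
  have D: "D > 0" using \<beta>0 d \<gamma> by (simp add: D_def add_nonneg_pos)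
  have "D * s \<le> 2 * \<beta> * (d - 1) + 2 * \<gamma> + ((d - \<beta>) * 2 * \<gamma> - (d - 1) * \<beta>) * m"
  \<comment> \<open>For \<beta> = 0 the threshold is 1 and no admissible \<theta> < 1 remains above
    it, but the claimed bound then coincides with \<open>recip_add_le_third\<close>.\<close>
  proof (cases "\<beta> = 0")
    case True
    then show ?thesis
      using mult_left_mono[OF recip_add_le_third[OF bdd E], of "2 * \<gamma>"] \<gamma>(2) by (simp add: D_def s_def m_def d_def algebra_simps)
  next
    case False
    with \<beta>0 have \<beta>pos: "\<beta> > 0" by simp
    define \<theta>0 where "\<theta>0 = 1 - \<beta> / \<gamma>"
    have \<theta>0: "0 \<le> \<theta>0" "\<theta>0 < 1" using \<beta>pos \<beta>\<gamma> \<gamma>(2) by (auto simp: \<theta>0_def)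
    \<comment> \<open>Both sides are affine in \<theta>, so replacing \<theta>0 by \<theta>0 +
      \<epsilon> changes the inequality by a fixed multiple of \<epsilon>.\<close>
    have "((1 - \<theta>0) / 2 * (d - 1) + 1) * s
      \<le> (1 - \<theta>0) * (d - 1) + 1 + ((1 + \<theta>0) / 2 * (d - 1) + 1 - (1 - \<theta>0) * \<gamma>) * m"
    proof (rule le_add_mult_epsilon)
      show "0 < 1 - \<theta>0" using \<theta>0 by simp
      fix \<epsilon> assume \<epsilon>: "0 < \<epsilon>" "\<epsilon> < 1 - \<theta>0"
      let ?t = "\<theta>0 + \<epsilon>"
      have "1 - minkowski_dim E / assouad_dim E < ereal ?t"
        using \<epsilon> \<beta> \<gamma> by (simp add: one_ereal_def \<theta>0_def)
      then have "assouad_spectrum ?t E = ereal \<gamma>"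
        using reg \<epsilon> \<theta>0 \<gamma>(1) unfolding assouad_regular_def by force
      then have "((1 - ?t) / 2 * (d - 1) + 1) * s
        \<le> (1 - ?t) * (d - 1) + 1 + ((1 + ?t) / 2 * (d - 1) + 1 - (1 - ?t) * \<gamma>) * m"
        unfolding d_def s_def m_def using \<epsilon> \<theta>0 \<gamma>(2) by (intro recip_add_le_spectrum[OF bdd E(1)]) auto
      then show "((1 - \<theta>0) / 2 * (d - 1) + 1) * s
        \<le> (1 - \<theta>0) * (d - 1) + 1 + ((1 + \<theta>0) / 2 * (d - 1) + 1 - (1 - \<theta>0) * \<gamma>) * m
          + ((d - 1) * s / 2 - (d - 1) + ((d - 1) / 2 + \<gamma>) * m) * \<epsilon>"
        by (simp add: field_simps)
    qed
    \<comment> \<open>Multiplication by 2\<gamma> clears the denominators, as (1 - \<theta>0)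
      \<gamma> = \<beta>; the coefficient of \<open>s\<close> becomes \<open>D\<close>.\<close>
    then have "2 * \<gamma> * (((1 - \<theta>0) / 2 * (d - 1) + 1) * s)
      \<le> 2 * \<gamma> * ((1 - \<theta>0) * (d - 1) + 1 + ((1 + \<theta>0) / 2 * (d - 1) + 1 - (1 - \<theta>0) * \<gamma>) * m)"
      using \<gamma>(2) by (intro mult_left_mono) auto
    moreover have "2 * \<gamma> * (((1 - \<theta>0) / 2 * (d - 1) + 1) * s) = D * s"
      using \<gamma>(2) by (simp add: \<theta>0_def D_def field_simps)
    moreover have "2 * \<gamma> * ((1 - \<theta>0) * (d - 1) + 1 + ((1 + \<theta>0) / 2 * (d - 1) + 1 - (1 - \<theta>0) * \<gamma>) * m)
      = 2 * \<beta> * (d - 1) + 2 * \<gamma> + ((d - \<beta>) * 2 * \<gamma> - (d - 1) * \<beta>) * m"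
      using \<gamma>(2) by (simp add: \<theta>0_def field_simps)
    ultimately show ?thesis by (simp only:)
  qed
  then have "s \<le> (2 * \<beta> * (d - 1) + 2 * \<gamma> + ((d - \<beta>) * 2 * \<gamma> - (d - 1) * \<beta>) * m) / D"
    using D by (simp add: pos_le_divide_eq mult.commute)
  also have "\<dots> = 1 + (\<beta> * (d - 1) / D + ((d - \<beta>) * 2 * \<gamma> - (d - 1) * \<beta>) / D * m)"
  proof -
    have "2 * \<beta> * (d - 1) + 2 * \<gamma> = D + \<beta> * (d - 1)" by (simp add: D_def)
    then show ?thesis by (simp only: add_divide_distrib) (use D in simp)
  qed
  finally show ?thesis by (simp add: s_def m_def D_def)
qed

theorem proposition7p6:
  fixes E :: "real set" and \<beta> \<gamma> :: real and p q r :: ennreal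
  assumes "CARD('n::finite) \<ge> 2"
    and "E \<subseteq> {1..2}" and "E \<noteq> {}"
    and "assouad_regular E"
    and "minkowski_dim E = ereal \<beta>"
    and "assouad_dim E = ereal \<gamma>" and "\<gamma> > 0"
    and "1 \<le> p" and "1 \<le> q" and "r > 0"
    and "spherical_maximal_bounded TYPE(real^'n) E p q r"
  shows "recip r \<le> recip p + recip q \<and>
         recip p + recip q \<le> 1 + m_linear CARD('n) r \<beta> \<gamma>"
proof -
  have "0 < p" "0 < q" using assms(8,9) by (auto intro: less_le_trans[OF zero_less_one])
  note bdd = assms(11) this assms(10) and E = assms(2,3)
  define d where "d = real CARD('n)"
  have d: "d \<ge> 2" using assms(1) by (simp add: d_def)
  have "d * (recip p + recip q) \<le> 2 * d - 1 + (1 - \<beta>) * recip r"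
    using recip_add_le_first[OF bdd E assms(5)] by (simp add: d_def)
  then have "recip p + recip q \<le> (2 * d - 1 + (1 - \<beta>) * recip r) / d"
    using d by (simp add: pos_le_divide_eq mult.commute)
  also have "\<dots> = 1 + ((d - 1) / d + (1 - \<beta>) / d * recip r)"
    using d by (simp add: field_simps)
  finally have "recip p + recip q \<le> 1 + ((d - 1) / d + (1 - \<beta>) / d * recip r)" .
  moreover have "recip p + recip q \<le> 1 + (\<beta> * (d - 1) / (\<beta> * (d - 1) + 2 * \<gamma>)
       + ((d - \<beta>) * 2 * \<gamma> - (d - 1) * \<beta>) / (\<beta> * (d - 1) + 2 * \<gamma>) * recip r)"
    using recip_add_le_second[OF bdd E assms(4-7)] by (simp add: d_def)
  moreover have "recip p + recip q \<le> 1 + d * recip r"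
    using recip_add_le_third[OF bdd E] by (simp add: d_def)
  ultimately show ?thesis
    using recip_le_recip_add[OF bdd E] by (simp add: m_linear_def d_def)
qed

end
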